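(* Assume that $P$ is irreducible. For any real functions $\psi$ and $f$ defined on $E$, we have: - The estimator $\mathcal I_n(f,\psi)$ of $\langle\pi,f\rangle$ is consistent: almost surely, $\lim_{n\to\infty}\mathcal I_n(f,\psi)=\langle\pi,f\rangle$. - The estimator $\mathcal I_n(f,\psi)$ of $\langle\pi,f\rangle$ is asymptotically normal: $$\sqrt n\,\big(\mathcal I_n(f,\psi)-\langle\pi,f\rangle\big)\xrightarrow[n\to\infty]{(d)}\mathcal N(0,\sigma(f,\psi)^2),$$ where the asymptotic variance is $$\sigma(f,\psi)^2=\sigma(f)^2+\sum_{x\in E,\,A\in\mathcal P(E)}\pi(x)\mathcal Q(x,A)\big[\mathrm{Var}_{\kappa_{x,A}}(\psi-F)-\mathrm{Var}_{\kappa_{x,A}}(F)\big],$$ with $\mathrm{Var}_{\kappa_{x,A}}(g)=\sum_{y\in A}\kappa(x,A,y)g(y)^2-\Big(\sum_{y\in A}\kappa(x,A,y)g(y)\Big)^2$. - Moreover, for fixed $f$, the asymptotic variance $\sigma(f,\psi)^2$ is minimal (over real functions $\psi$ on $E$) for $\psi=F$, where $F$ solves the Poisson equation $F-PF=f-\langle\pi,f\rangle$. In particular, this choice achieves variance reduction: $\sigma(f,F)^2\le\sigma(f)^2$.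
   Context: Let $E$ be a finite set, $\pi$ a probability measure on $E$ with $\pi(x)>0$ for all $x\in E$, $\langle\pi,h\rangle=\sum_{x}\pi(x)h(x)$, and $\mathcal P(E)$ the set of subsets of $E$. Proposition kernel: $\mathcal Q:E\times\mathcal P(E)\to[0,1]$ with, for all $x\in E$, $\mathcal Q(x,A)=0$ if $x\notin A$ and $\sum_{A\in\mathcal P(E)}\mathcal Q(x,A)=1$. Selection probability: for $A\in\mathcal P(E)$ and $x\in A$, $\kappa(x,A,\cdot)$ is a probability on $A$ (i.e. $\kappa(x,A,\tilde x)\in[0,1]$ and $\sum_{\tilde x\in A}\kappa(x,A,\tilde x)=1$), with $$\forall A\in\mathcal P(E),\ \forall x,\tilde x\in A,\quad \pi(x)\mathcal Q(x,A)\kappa(x,A,\tilde x)=\pi(\tilde x)\mathcal Q(\tilde x,A)\kappa(\tilde x,A,x).$$ Markov chain: $X_0$ has an arbitrary distribution $\nu_0$ on $E$; given the past up to step $n$, the proposal set $A_{n+1}$ is distributed according to $\mathcal Q(X_n,\cdot)$, then $X_{n+1}$ is distributed according to $\kappa(X_n,A_{n+1},\cdot)$. The transition matrix is $P(x,y)=\sum_{A\in\mathcal P(E):\,x,y\in A}\mathcal Q(x,A)\kappa(x,A,y)$; it is reversible with respect to $\pi$. Write $Ph(x)=\sum_yP(x,y)h(y)$. For real functions $f,\psi$ on $E$: $I_n(f)=\frac1n\sum_{k=1}^nf(X_k)$, $$\mathcal J_n(\psi)=\frac1n\sum_{k=0}^{n-1}\Big(\sum_{\tilde x\in A_{k+1}}\kappa(X_k,A_{k+1},\tilde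 x)\psi(\tilde x)-\psi(X_{k+1})\Big),\qquad \mathcal I_n(f,\psi)=I_n(f)+\mathcal J_n(\psi).$$ $F$ denotes the solution (unique up to an additive constant) of the Poisson equation $F-PF=f-\langle\pi,f\rangle$, and $\sigma(f)^2=\langle\pi,F^2\rangle-\langle\pi,(PF)^2\rangle$. *)

theory Defs
  imports "HOL-Probability.Probability"
begin

text \<open>
  The state space \<open>E\<close> is the universe of a finite type \<^typ>\<open>'a::finite\<close>, so \<open>\<P>(E)\<close> is the type
  \<^typ>\<open>'a set\<close>. All measures and kernels are given by their real-valued weights.
\<close>

definition positive_prob :: "('a::finite \<Rightarrow> real) \<Rightarrow> bool" where
  "positive_prob \<pi> \<longleftrightarrow> (\<forall>x. 0 < \<pi> x) \<and> (\<Sum>x\<in>UNIV. \<pi> x) = 1"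

definition mean :: "('a::finite \<Rightarrow> real) \<Rightarrow> ('a \<Rightarrow> real) \<Rightarrow> real" where
  "mean \<pi> h = (\<Sum>x\<in>UNIV. \<pi> x * h x)"

definition proposal_kernel :: "('a::finite \<Rightarrow> 'a set \<Rightarrow> real) \<Rightarrow> bool" where
  "proposal_kernel Q \<longleftrightarrow>
     (\<forall>x A. 0 \<le> Q x A \<and> Q x A \<le> 1) \<and>
     (\<forall>x A. x \<notin> A \<longrightarrow> Q x A = 0) \<and>
     (\<forall>x. (\<Sum>A\<in>UNIV. Q x A) = 1)"

text \<open>
  \<open>\<kappa> x A y\<close> is meaningful for \<open>x \<in> A\<close> and \<open>y \<in> A\<close> only; its other values are left unconstrained
  and do not influence any of the quantities below.
\<close>

definition selection_probability :: "('a::finite \<Rightarrow> 'a set \<Rightarrow> 'a \<Rightarrow> real) \<Rightarrow> bool" where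
  "selection_probability \<kappa> \<longleftrightarrow>
     (\<forall>A. \<forall>x\<in>A. (\<forall>y\<in>A. 0 \<le> \<kappa> x A y \<and> \<kappa> x A y \<le> 1) \<and> (\<Sum>y\<in>A. \<kappa> x A y) = 1)"

definition balanced ::
  "('a::finite \<Rightarrow> real) \<Rightarrow> ('a \<Rightarrow> 'a set \<Rightarrow> real) \<Rightarrow> ('a \<Rightarrow> 'a set \<Rightarrow> 'a \<Rightarrow> real) \<Rightarrow> bool" where
  "balanced \<pi> Q \<kappa> \<longleftrightarrow>
     (\<forall>A. \<forall>x\<in>A. \<forall>y\<in>A. \<pi> x * Q x A * \<kappa> x A y = \<pi> y * Q y A * \<kappa> y A x)"

definition transition ::
  "('a::finite \<Rightarrow> 'a set \<Rightarrow> real) \<Rightarrow> ('a \<Rightarrow> 'a set \<Rightarrow> 'a \<Rightarrow> real) \<Rightarrow> 'a \<Rightarrow> 'a \<Rightarrow> real" where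
  "transition Q \<kappa> x y = (\<Sum>A | x \<in> A \<and> y \<in> A. Q x A * \<kappa> x A y)"

definition apply_matrix :: "('a::finite \<Rightarrow> 'a \<Rightarrow> real) \<Rightarrow> ('a \<Rightarrow> real) \<Rightarrow> 'a \<Rightarrow> real" where
  "apply_matrix P h x = (\<Sum>y\<in>UNIV. P x y * h y)"

primrec n_step :: "('a::finite \<Rightarrow> 'a \<Rightarrow> real) \<Rightarrow> nat \<Rightarrow> 'a \<Rightarrow> 'a \<Rightarrow> real" where
  "n_step P 0 x y = (if x = y then 1 else 0)"
| "n_step P (Suc n) x y = (\<Sum>z\<in>UNIV. P x z * n_step P n z y)"

definition irreducible_matrix :: "('a::finite \<Rightarrow> 'a \<Rightarrow> real) \<Rightarrow> bool" where
  "irreducible_matrix P \<longleftrightarrow> (\<forall>x y. \<exists>n. 0 < n_step P n x y)"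

text \<open>
  The event that \<open>X\<^sub>0, A\<^sub>1, X\<^sub>1, \<dots>, A\<^sub>n, X\<^sub>n\<close> follows the trajectory \<open>x\<^sub>0, a\<^sub>1, x\<^sub>1, \<dots>, a\<^sub>n, x\<^sub>n\<close>. There is
  no proposal set at time \<open>0\<close>: \<open>A 0\<close> is never used.
\<close>

definition past ::
  "(nat \<Rightarrow> 'w \<Rightarrow> 'a) \<Rightarrow> (nat \<Rightarrow> 'w \<Rightarrow> 'a set) \<Rightarrow> (nat \<Rightarrow> 'a) \<Rightarrow> (nat \<Rightarrow> 'a set) \<Rightarrow> nat \<Rightarrow> 'w \<Rightarrow> bool" where
  "past X A x a n \<omega> \<longleftrightarrow> (\<forall>k\<le>n. X k \<omega> = x k) \<and> (\<forall>k\<in>{1..n}. A k \<omega> = a k)"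

definition proposal_chain ::
  "'w measure \<Rightarrow> ('a::finite \<Rightarrow> real) \<Rightarrow> ('a \<Rightarrow> 'a set \<Rightarrow> real) \<Rightarrow> ('a \<Rightarrow> 'a set \<Rightarrow> 'a \<Rightarrow> real) \<Rightarrow>
    (nat \<Rightarrow> 'w \<Rightarrow> 'a) \<Rightarrow> (nat \<Rightarrow> 'w \<Rightarrow> 'a set) \<Rightarrow> bool" where
  "proposal_chain M \<nu>\<^sub>0 Q \<kappa> X A \<longleftrightarrow>
     prob_space M \<and>
     (\<forall>n. X n \<in> measurable M (count_space UNIV)) \<and>
     (\<forall>n. A (Suc n) \<in> measurable M (count_space UNIV)) \<and>
     (\<forall>x. \<P>(\<omega> in M. X 0 \<omega> = x) = \<nu>\<^sub>0 x) \<and>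
     (\<forall>n x a B. \<P>(\<omega> in M. past X A x a n \<omega>) > 0 \<longrightarrow>
        \<P>(\<omega> in M. A (Suc n) \<omega> = B \<bar> past X A x a n \<omega>) = Q (x n) B) \<and>
     (\<forall>n x a B. \<forall>y\<in>B. \<P>(\<omega> in M. past X A x a n \<omega> \<and> A (Suc n) \<omega> = B) > 0 \<longrightarrow>
        \<P>(\<omega> in M. X (Suc n) \<omega> = y \<bar> past X A x a n \<omega> \<and> A (Suc n) \<omega> = B) = \<kappa> (x n) B y)"

definition empirical_mean :: "(nat \<Rightarrow> 'w \<Rightarrow> 'a) \<Rightarrow> ('a \<Rightarrow> real) \<Rightarrow> nat \<Rightarrow> 'w \<Rightarrow> real" where
  "empirical_mean X f n \<omega> = (1 / real n) * (\<Sum>k=1..n. f (X k \<omega>))"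

definition correction ::
  "('a \<Rightarrow> 'a set \<Rightarrow> 'a \<Rightarrow> real) \<Rightarrow> (nat \<Rightarrow> 'w \<Rightarrow> 'a) \<Rightarrow> (nat \<Rightarrow> 'w \<Rightarrow> 'a set) \<Rightarrow> ('a \<Rightarrow> real) \<Rightarrow>
    nat \<Rightarrow> 'w \<Rightarrow> real" where
  "correction \<kappa> X A \<psi> n \<omega> =
     (1 / real n) * (\<Sum>k<n. (\<Sum>y\<in>A (Suc k) \<omega>. \<kappa> (X k \<omega>) (A (Suc k) \<omega>) y * \<psi> y) - \<psi> (X (Suc k) \<omega>))"

definition estimator ::
  "('a \<Rightarrow> 'a set \<Rightarrow> 'a \<Rightarrow> real) \<Rightarrow> (nat \<Rightarrow> 'w \<Rightarrow> 'a) \<Rightarrow> (nat \<Rightarrow> 'w \<Rightarrow> 'a set) \<Rightarrow> ('a \<Rightarrow> real) \<Rightarrow>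
    ('a \<Rightarrow> real) \<Rightarrow> nat \<Rightarrow> 'w \<Rightarrow> real" where
  "estimator \<kappa> X A f \<psi> n \<omega> = empirical_mean X f n \<omega> + correction \<kappa> X A \<psi> n \<omega>"

definition poisson_solution ::
  "('a::finite \<Rightarrow> real) \<Rightarrow> ('a \<Rightarrow> 'a \<Rightarrow> real) \<Rightarrow> ('a \<Rightarrow> real) \<Rightarrow> ('a \<Rightarrow> real) \<Rightarrow> bool" where
  "poisson_solution \<pi> P f F \<longleftrightarrow> (\<forall>x. F x - apply_matrix P F x = f x - mean \<pi> f)"

definition variance_kappa ::
  "('a \<Rightarrow> 'a set \<Rightarrow> 'a \<Rightarrow> real) \<Rightarrow> 'a \<Rightarrow> 'a set \<Rightarrow> ('a \<Rightarrow> real) \<Rightarrow> real" where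
  "variance_kappa \<kappa> x A g = (\<Sum>y\<in>A. \<kappa> x A y * (g y)\<^sup>2) - (\<Sum>y\<in>A. \<kappa> x A y * g y)\<^sup>2"

text \<open>
  The asymptotic variances \<open>\<sigma>(f)\<^sup>2\<close> and \<open>\<sigma>(f,\<psi>)\<^sup>2\<close>, as functions of a solution \<open>F\<close> of the Poisson
  equation for \<open>f\<close>.
\<close>

definition asymp_var :: "('a::finite \<Rightarrow> real) \<Rightarrow> ('a \<Rightarrow> 'a \<Rightarrow> real) \<Rightarrow> ('a \<Rightarrow> real) \<Rightarrow> real" where
  "asymp_var \<pi> P F = mean \<pi> (\<lambda>x. (F x)\<^sup>2) - mean \<pi> (\<lambda>x. (apply_matrix P F x)\<^sup>2)"

definition asymp_var_cv ::
  "('a::finite \<Rightarrow> real) \<Rightarrow> ('a \<Rightarrow> 'a set \<Rightarrow> real) \<Rightarrow> ('a \<Rightarrow> 'a set \<Rightarrow> 'a \<Rightarrow> real) \<Rightarrow> ('a \<Rightarrow> real) \<Rightarrow>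
    ('a \<Rightarrow> real) \<Rightarrow> real" where
  "asymp_var_cv \<pi> Q \<kappa> F \<psi> = asymp_var \<pi> (transition Q \<kappa>) F +
     (\<Sum>x\<in>UNIV. \<Sum>A\<in>UNIV. \<pi> x * Q x A *
        (variance_kappa \<kappa> x A (\<lambda>y. \<psi> y - F y) - variance_kappa \<kappa> x A F))"

text \<open>The normal law with variance \<open>v \<ge> 0\<close>, which is a Dirac mass for \<open>v = 0\<close>.\<close>

definition normal_law :: "real \<Rightarrow> real \<Rightarrow> real measure" where
  "normal_law m v = (if v = 0 then return borel m else density lborel (normal_density m (sqrt v)))"

end

theory Submission
  imports Defs "HOL-Real_Asymp.Real_Asymp"
begin

text \<open>
  With \<open>F\<close> a solution of the Poisson equation, \<open>n (\<I>\<^sub>n(f,\<psi>) - \<langle>\<pi>,f\<rangle>)\<close> is, up to the bounded boundary term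
  \<open>PF(X\<^sub>0) - PF(X\<^sub>n)\<close>, a martingale \<open>S\<^sub>n\<close> with bounded increments
  \<open>g(x,A,y) = F(y) - PF(x) + \<langle>\<kappa>(x,A,\<cdot>),\<psi>\<rangle> - \<psi>(y)\<close>. Its fourth moment is \<open>O(n\<^sup>2)\<close>, so \<open>S\<^sub>n / n\<close> tends to \<open>0\<close>
  almost surely. For the central limit theorem, let \<open>s\<close> be the stationary mean of the conditional
  variance \<open>v(x)\<close> of an increment, and let \<open>H\<close> solve the Poisson equation \<open>H - PH = v - s\<close>. Then
  \<open>a\<^sub>n = E[exp(i\<theta>S\<^sub>n) (1 - \<theta>\<^sup>2 H(X\<^sub>n) / 2)]\<close> satisfies \<open>a\<^sub>n\<^sub>+\<^sub>1 = (1 - \<theta>\<^sup>2 s / 2) a\<^sub>n + O(\<theta>\<^sup>3)\<close>; taking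
  \<open>\<theta> = t / \<surd>n\<close> gives the limit \<open>exp(-s t\<^sup>2 / 2)\<close> of the characteristic functions. Finally \<open>s\<close> is the claimed
  asymptotic variance, in which \<open>\<psi>\<close> only enters through the nonnegative terms \<open>Var(\<psi> - F)\<close>.
\<close>

subsection \<open>Kernels, the Poisson equation and the asymptotic variance\<close>

text \<open>The conditional expectation of \<phi>(A_{n+1}, X_{n+1}) given X_n = x. Vector values let
  it serve both real moments and complex transforms; \<open>y\<close> ranges over \<open>B\<close>
  because \<open>\<kappa> x B\<close> is meaningful only there.\<close>

definition step_mean ::
  "('a::finite \<Rightarrow> 'a set \<Rightarrow> real) \<Rightarrow> ('a \<Rightarrow> 'a set \<Rightarrow> 'a \<Rightarrow> real) \<Rightarrow> 'a \<Rightarrow>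
    ('a set \<Rightarrow> 'a \<Rightarrow> 'b::real_normed_vector) \<Rightarrow> 'b" where
  "step_mean Q \<kappa> x \<phi> = (\<Sum>B\<in>UNIV. \<Sum>y\<in>B. (Q x B * \<kappa> x B y) *\<^sub>R \<phi> B y)"

locale proposal_pair =
  fixes Q :: "'a::finite \<Rightarrow> 'a set \<Rightarrow> real" and \<kappa> :: "'a \<Rightarrow> 'a set \<Rightarrow> 'a \<Rightarrow> real"
  assumes proposal: "proposal_kernel Q" and selection: "selection_probability \<kappa>"
begin

lemma Q_nonneg: "0 \<le> Q x B"
  and Q_outside: "x \<notin> B \<Longrightarrow> Q x B = 0"
  and Q_sum: "(\<Sum>B\<in>UNIV. Q x B) = 1"
  using proposal by (auto simp: proposal_kernel_def)

lemma \<kappa>_nonneg: "x \<in> B \<Longrightarrow> y \<in> B \<Longrightarrow> 0 \<le> \<kappa> x B y"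
  and \<kappa>_sum: "x \<in> B \<Longrightarrow> (\<Sum>y\<in>B. \<kappa> x B y) = 1"
  using selection by (auto simp: selection_probability_def)

text \<open>For \<open>x\<close> outside \<open>B\<close> the number \<open>\<kappa> x B y\<close>
  may have any sign, but then the factor \<open>Q x B\<close> is 0.\<close>

lemma weight_nonneg: "y \<in> B \<Longrightarrow> 0 \<le> Q x B * \<kappa> x B y"
  using Q_nonneg Q_outside \<kappa>_nonneg by (cases "x \<in> B") auto

lemma weight_sum: "(\<Sum>y\<in>B. Q x B * \<kappa> x B y) = Q x B"
  using Q_outside \<kappa>_sum by (cases "x \<in> B") (auto simp flip: sum_distrib_left)

lemma step_mean_const: "step_mean Q \<kappa> x (\<lambda>B y. c) = c"
  by (simp add: step_mean_def weight_sum Q_sum flip: scaleR_sum_left)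

lemma step_mean_add:
  "step_mean Q \<kappa> x (\<lambda>B y. \<phi> B y + \<phi>' B y) = step_mean Q \<kappa> x \<phi> + step_mean Q \<kappa> x \<phi>'"
  by (simp add: step_mean_def scaleR_add_right sum.distrib)

lemma step_mean_diff:
  "step_mean Q \<kappa> x (\<lambda>B y. \<phi> B y - \<phi>' B y) = step_mean Q \<kappa> x \<phi> - step_mean Q \<kappa> x \<phi>'"
  by (simp add: step_mean_def scaleR_diff_right sum_subtractf)

lemma step_mean_mult:
  fixes \<phi> :: "'a set \<Rightarrow> 'a \<Rightarrow> 'b::real_normed_algebra"
  shows "step_mean Q \<kappa> x (\<lambda>B y. c * \<phi> B y) = c * step_mean Q \<kappa> x \<phi>"
  by (simp add: step_mean_def sum_distrib_left)

lemma step_mean_of_real: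
  "step_mean Q \<kappa> x (\<lambda>B y. complex_of_real (\<phi> B y)) = complex_of_real (step_mean Q \<kappa> x \<phi>)"
  by (simp add: step_mean_def scaleR_conv_of_real)

text \<open>The weights are nonnegative and have total mass 1, so averaging cannot exceed a uniform
  bound.\<close>

lemma norm_step_mean_le:
  assumes "\<And>B y. norm (\<phi> B y) \<le> C"
  shows "norm (step_mean Q \<kappa> x \<phi>) \<le> C"
proof -
  have "norm (step_mean Q \<kappa> x \<phi>) \<le> (\<Sum>B\<in>UNIV. \<Sum>y\<in>B. (Q x B * \<kappa> x B y) * C)"
    unfolding step_mean_def
    by (intro order.trans[OF norm_sum] sum_mono)
      (auto simp only: norm_scaleR abs_of_nonneg[OF weight_nonneg] intro!: mult_left_mono weight_nonneg assms)
  also have "\<dots> = C"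
    using step_mean_const[of x C] by (simp add: step_mean_def)
  finally show ?thesis .
qed

lemma step_mean_fiber: 
  fixes \<phi> :: "'a set \<Rightarrow> 'a \<Rightarrow> real"
  shows "step_mean Q \<kappa> x \<phi> = (\<Sum>B\<in>UNIV. Q x B * (\<Sum>y\<in>B. \<kappa> x B y * \<phi> B y))"
  by (simp add: step_mean_def sum_distrib_left mult.assoc)

lemma apply_transition:
  "apply_matrix (transition Q \<kappa>) h x = step_mean Q \<kappa> x (\<lambda>B y. h y)"
proof -
  have "transition Q \<kappa> x y * h y = (\<Sum>B\<in>UNIV. if y \<in> B then Q x B * \<kappa> x B y * h y else 0)" for y
  proof -
    have "transition Q \<kappa> x y * h y = (\<Sum>B | x \<in> B \<and> y \<in> B. Q x B * \<kappa> x B y * h y)"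
      by (simp add: transition_def sum_distrib_right)
    also have "\<dots> = (\<Sum>B\<in>UNIV. if y \<in> B then Q x B * \<kappa> x B y * h y else 0)"
      by (rule sum.mono_neutral_cong_left) (auto, metis Q_outside)
    finally show ?thesis .
  qed
  then have "apply_matrix (transition Q \<kappa>) h x =
      (\<Sum>y\<in>UNIV. \<Sum>B\<in>UNIV. if y \<in> B then Q x B * \<kappa> x B y * h y else 0)"
    by (simp add: apply_matrix_def)
  also have "\<dots> = (\<Sum>B\<in>UNIV. \<Sum>y\<in>UNIV. if y \<in> B then Q x B * \<kappa> x B y * h y else 0)"
    by (rule sum.swap)
  finally show ?thesis by (simp add: step_mean_def sum.If_cases)
qed

section \<open>Harmonic functions, stationarity and the Poisson equation\<close>

lemma transition_nonneg: "0 \<le> transition Q \<kappa> x y"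
  unfolding transition_def by (rule sum_nonneg) (auto intro: weight_nonneg)

lemma transition_sum: "(\<Sum>y\<in>UNIV. transition Q \<kappa> x y) = 1"
  using apply_transition[of "\<lambda>_. 1" x] step_mean_const[of x "1::real"] by (simp add: apply_matrix_def)

lemma n_step_nonneg: "0 \<le> n_step (transition Q \<kappa>) n x y"
  by (induction n arbitrary: x) (auto intro!: sum_nonneg mult_nonneg_nonneg transition_nonneg)

lemma n_step_harmonic:
  assumes "\<And>x. apply_matrix (transition Q \<kappa>) h x = h x"
  shows "(\<Sum>y\<in>UNIV. n_step (transition Q \<kappa>) n x y * h y) = h x"
proof (induction n arbitrary: x)
  case (Suc n)
  have "(\<Sum>y\<in>UNIV. n_step (transition Q \<kappa>) (Suc n) x y * h y) =
      (\<Sum>z\<in>UNIV. transition Q \<kappa> x z * (\<Sum>y\<in>UNIV. n_step (transition Q \<kappa>) n z y * h y))"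
    by (simp add: sum_distrib_right sum_distrib_left mult.assoc) (rule sum.swap)
  then show ?case using Suc assms[of x] by (simp add: apply_matrix_def)
qed (simp add: if_distrib[of "\<lambda>c. c * _"] cong: if_cong)

text \<open>Maximum principle: at a maximiser \<open>x0\<close>, the value \<open>m\<close> is an
  average of \<open>h\<close> over the \<open>n\<close>-step law for every \<open>n\<close>, so
  \<open>h\<close> equals \<open>m\<close> at each reachable state, and irreducibility reaches them
  all.\<close>

lemma harmonic_constant:
  assumes irr: "irreducible_matrix (transition Q \<kappa>)"
    and h: "\<And>x. apply_matrix (transition Q \<kappa>) h x = h x"
  shows "h x = h y"
proof -
  define m where "m = Max (range h)"
  have le: "h z \<le> m" for z by (simp add: m_def)
  have "m \<in> range h" unfolding m_def by (rule Max_in) auto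
  then obtain x0 where x0: "h x0 = m" by auto
  have "h y = m" for y
  proof -
    obtain n where n: "0 < n_step (transition Q \<kappa>) n x0 y"
      using irr by (auto simp: irreducible_matrix_def)
    \<comment> \<open>The constant 1 is harmonic as well, so \<open>n_step_harmonic\<close> also
      shows that the rows of \<open>n_step\<close> sum to 1.\<close>
    have one: "apply_matrix (transition Q \<kappa>) (\<lambda>_. 1) x = 1" for x
      by (simp add: apply_matrix_def transition_sum)
    have "(\<Sum>z\<in>UNIV. n_step (transition Q \<kappa>) n x0 z * (m - h z)) = 0"
      using n_step_harmonic[OF h, of n x0] n_step_harmonic[of "\<lambda>_. 1", OF one, of n x0] x0
      by (simp add: right_diff_distrib sum_subtractf flip: sum_distrib_right)
    moreover have "0 \<le> n_step (transition Q \<kappa>) n x0 z * (m - h z)" for z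
      using n_step_nonneg le[of z] by simp
    ultimately have "n_step (transition Q \<kappa>) n x0 y * (m - h y) = 0"
      by (simp add: sum_nonneg_eq_0_iff)
    then show ?thesis using n by simp
  qed
  then show ?thesis by simp
qed

text \<open>Summing the balance condition over the proposal sets makes \<open>transition\<close>
  reversible with respect to \<pi>; summing out one variable then gives invariance.\<close>

lemma stationary:
  assumes "balanced \<pi> Q \<kappa>"
  shows "mean \<pi> (apply_matrix (transition Q \<kappa>) h) = mean \<pi> h"
proof -
  have rev: "\<pi> x * transition Q \<kappa> x y = \<pi> y * transition Q \<kappa> y x" for x y
    using assms by (auto simp: transition_def sum_distrib_left balanced_def mult.assoc conj_commute
        intro!: sum.cong)
  have "mean \<pi> (apply_matrix (transition Q \<kappa>) h) =
      (\<Sum>x\<in>UNIV. \<Sum>y\<in>UNIV. \<pi> x * transition Q \<kappa> x y * h y)"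
    by (simp add: mean_def apply_matrix_def sum_distrib_left mult.assoc)
  also have "\<dots> = (\<Sum>x\<in>UNIV. \<Sum>y\<in>UNIV. \<pi> y * h y * transition Q \<kappa> y x)"
    by (intro sum.cong refl, subst rev) simp
  also have "\<dots> = (\<Sum>y\<in>UNIV. \<Sum>x\<in>UNIV. \<pi> y * h y * transition Q \<kappa> y x)"
    by (rule sum.swap)
  also have "\<dots> = mean \<pi> h"
    by (simp add: mean_def transition_sum flip: sum_distrib_left)
  finally show ?thesis .
qed

text \<open>The operator \<open>h - P h + \<langle>\<pi>, h\<rangle>\<close> is injective, hence onto; on centred functions its inverse
  solves the Poisson equation.\<close>
lemma poisson_solution_exists:
  assumes \<pi>: "positive_prob \<pi>" and bal: "balanced \<pi> Q \<kappa>"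
    and irr: "irreducible_matrix (transition Q \<kappa>)"
  shows "\<exists>F. poisson_solution \<pi> (transition Q \<kappa>) f F"
proof -
  let ?P = "apply_matrix (transition Q \<kappa>)"
  \<comment> \<open>Functions are encoded as vectors, so that injectivity of a linear endomorphism
    of a finite-dimensional space yields surjectivity.\<close>
  define L :: "real^'a \<Rightarrow> real^'a" where
    "L h = (\<chi> x. h $ x - ?P (($) h) x + mean \<pi> (($) h))" for h
  have \<pi>1: "(\<Sum>x\<in>UNIV. \<pi> x) = 1" using \<pi> by (simp add: positive_prob_def)
  \<comment> \<open>\<open>L\<close> preserves the mean. Hence both a kernel element and a preimage
    of a centred function are centred, and on them the term \<open>mean \<pi> h\<close> of
    \<open>L\<close> disappears.\<close>
  have mean_L: "mean \<pi> (($) (L h)) = mean \<pi> (($) h)" for h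
  proof -
    have "mean \<pi> (($) (L h)) = mean \<pi> (($) h) - mean \<pi> (?P (($) h)) + mean \<pi> (($) h)"
      using \<pi>1 by (simp add: L_def mean_def ring_distribs sum.distrib sum_subtractf flip: sum_distrib_right)
    then show ?thesis using stationary[OF bal] by simp
  qed
  have lin: "linear L"
    by (rule linearI)
      (auto simp: L_def vec_eq_iff apply_matrix_def mean_def ring_distribs sum.distrib
        sum_distrib_left mult_ac sum_negf)
  \<comment> \<open>A kernel element is centred, hence harmonic, hence constant and equal to its
    mean 0.\<close>
  have "h = 0" if "L h = 0" for h
  proof -
    have m: "mean \<pi> (($) h) = 0" using mean_L[of h] that by (simp add: mean_def)
    then have "?P (($) h) x = h $ x" for x
      using that by (simp add: L_def vec_eq_iff)
    then have c: "h $ x = h $ y" for x y using harmonic_constant[OF irr] by blast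
    then have "mean \<pi> (($) h) = h $ x" for x
    proof -
      have "mean \<pi> (($) h) = (\<Sum>y\<in>UNIV. \<pi> y * h $ x)"
        unfolding mean_def by (intro sum.cong refl arg_cong2[of _ _ _ _ "(*)"] c)
      then show ?thesis using \<pi>1 by (simp flip: sum_distrib_right)
    qed
    then show ?thesis using m by (simp add: vec_eq_iff)
  qed
  then have "inj L" using lin by (simp add: linear_injective_0)
  then have "surj L" using lin by (simp add: linear_injective_imp_surjective)
  then obtain h where h: "L h = (\<chi> x. f x - mean \<pi> f)" by (metis surjD)
  have "mean \<pi> (($) h) = mean \<pi> (\<lambda>x. f x - mean \<pi> f)"
    using mean_L[of h] by (simp add: h mean_def)
  also have "\<dots> = 0"
    using \<pi>1 by (simp add: mean_def right_diff_distrib sum_subtractf flip: sum_distrib_right)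
  finally have "poisson_solution \<pi> (transition Q \<kappa>) f (($) h)"
    using h by (simp add: poisson_solution_def L_def vec_eq_iff)
  then show ?thesis by blast
qed

section \<open>Martingale increments and the asymptotic variance\<close>

definition increment :: "('a \<Rightarrow> real) \<Rightarrow> ('a \<Rightarrow> real) \<Rightarrow> 'a \<Rightarrow> 'a set \<Rightarrow> 'a \<Rightarrow> real" where
  "increment F \<psi> x B y =
    F y - apply_matrix (transition Q \<kappa>) F x + (\<Sum>z\<in>B. \<kappa> x B z * \<psi> z) - \<psi> y"

text \<open>Conditioning on the proposal set: only the \<kappa>-averages inside sets
  \<open>B\<close> containing \<open>x\<close> count, the others having weight 0.\<close>

lemma step_mean_cong_fiber:
  fixes \<phi> \<phi>' :: "'a set \<Rightarrow> 'a \<Rightarrow> real"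
  assumes "\<And>B. x \<in> B \<Longrightarrow> (\<Sum>y\<in>B. \<kappa> x B y * \<phi> B y) = (\<Sum>y\<in>B. \<kappa> x B y * \<phi>' B y)"
  shows "step_mean Q \<kappa> x \<phi> = step_mean Q \<kappa> x \<phi>'"
  unfolding step_mean_fiber using assms Q_outside
  by (intro sum.cong refl) (metis mult_zero_left)

text \<open>The \<psi> part is centred within each proposal set; the remaining part
  \<open>F y - PF x\<close> is centred over the whole step, by the definition of
  \<open>P\<close>.\<close>

lemma step_mean_increment: "step_mean Q \<kappa> x (increment F \<psi> x) = 0"
proof -
  have "step_mean Q \<kappa> x (increment F \<psi> x) =
      step_mean Q \<kappa> x (\<lambda>B y. F y - apply_matrix (transition Q \<kappa>) F x)"
    by (rule step_mean_cong_fiber)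
      (simp add: increment_def ring_distribs sum.distrib sum_subtractf \<kappa>_sum flip: sum_distrib_right)
  also have "\<dots> = 0"
    by (simp add: step_mean_diff step_mean_const apply_transition)
  finally show ?thesis .
qed

text \<open>Given \<open>B\<close>, the increment has conditional variance Var(\<psi> - F) and
  conditional mean \<open>a B - p\<close>. Writing \<open>(a B)\<^sup>2\<close> as the \<kappa>-mean
  of F^2 minus Var(F) and averaging over \<open>B\<close>, where \<open>a B\<close> has mean
  \<open>p\<close>, gives the formula.\<close>

lemma step_mean_increment_square:
  "step_mean Q \<kappa> x (\<lambda>B y. (increment F \<psi> x B y)\<^sup>2) =
    apply_matrix (transition Q \<kappa>) (\<lambda>y. (F y)\<^sup>2) x - (apply_matrix (transition Q \<kappa>) F x)\<^sup>2 +
    (\<Sum>B\<in>UNIV. Q x B * (variance_kappa \<kappa> x B (\<lambda>y. \<psi> y - F y) - variance_kappa \<kappa> x B F))"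
proof -
  define p where "p = apply_matrix (transition Q \<kappa>) F x"
  define a where "a B = (\<Sum>y\<in>B. \<kappa> x B y * F y)" for B
  define V where "V h B = variance_kappa \<kappa> x B h" for h B
  have fiber: "(\<Sum>y\<in>B. \<kappa> x B y * (increment F \<psi> x B y)\<^sup>2) =
      V (\<lambda>y. \<psi> y - F y) B - V F B + (\<Sum>y\<in>B. \<kappa> x B y * (F y)\<^sup>2) - 2 * p * a B + p\<^sup>2"
    if "x \<in> B" for B
  proof -
    define b where "b = (\<Sum>y\<in>B. \<kappa> x B y * (\<psi> y - F y))"
    \<comment> \<open>Once \<open>B\<close> is fixed, the increment is a constant minus \<psi> - F,
      whose \<kappa>-mean is \<open>b\<close>.\<close>
    have inc: "increment F \<psi> x B y = (b + a B - p) - (\<psi> y - F y)" for y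
      by (simp add: increment_def b_def a_def p_def ring_distribs sum_subtractf)
    have "(\<Sum>y\<in>B. \<kappa> x B y * (increment F \<psi> x B y)\<^sup>2) =
      (\<Sum>y\<in>B. \<kappa> x B y * (\<psi> y - F y)\<^sup>2 - 2 * (b + a B - p) * (\<kappa> x B y * (\<psi> y - F y))
        + (b + a B - p)\<^sup>2 * \<kappa> x B y)"
      unfolding inc by (intro sum.cong refl) (simp add: power2_eq_square algebra_simps)
    also have "\<dots> = (\<Sum>y\<in>B. \<kappa> x B y * (\<psi> y - F y)\<^sup>2) - 2 * (b + a B - p) * b + (b + a B - p)\<^sup>2"
      by (simp add: sum.distrib sum_subtractf \<kappa>_sum[OF that] b_def flip: sum_distrib_left)
    finally show ?thesis
      by (simp add: V_def variance_kappa_def a_def[symmetric] b_def[symmetric])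
        (simp add: power2_eq_square algebra_simps)
  qed
  have "step_mean Q \<kappa> x (\<lambda>B y. (increment F \<psi> x B y)\<^sup>2) =
     (\<Sum>B\<in>UNIV. Q x B * (V (\<lambda>y. \<psi> y - F y) B - V F B) + Q x B * (\<Sum>y\<in>B. \<kappa> x B y * (F y)\<^sup>2)
        - 2 * p * (Q x B * a B) + p\<^sup>2 * Q x B)"
    unfolding step_mean_fiber
  proof (intro sum.cong refl)
    fix B
    show "Q x B * (\<Sum>y\<in>B. \<kappa> x B y * (increment F \<psi> x B y)\<^sup>2) =
      Q x B * (V (\<lambda>y. \<psi> y - F y) B - V F B) + Q x B * (\<Sum>y\<in>B. \<kappa> x B y * (F y)\<^sup>2)
        - 2 * p * (Q x B * a B) + p\<^sup>2 * Q x B"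
      using Q_outside[of x B] by (cases "x \<in> B") (simp_all add: fiber ring_distribs)
  qed
  also have "\<dots> = (\<Sum>B\<in>UNIV. Q x B * (V (\<lambda>y. \<psi> y - F y) B - V F B))
      + (\<Sum>B\<in>UNIV. Q x B * (\<Sum>y\<in>B. \<kappa> x B y * (F y)\<^sup>2))
        - 2 * p * (\<Sum>B\<in>UNIV. Q x B * a B) + p\<^sup>2"
    by (simp add: sum.distrib sum_subtractf Q_sum flip: sum_distrib_left)
  also have "(\<Sum>B\<in>UNIV. Q x B * a B) = p"
    by (simp add: p_def apply_transition step_mean_fiber a_def)
  finally show ?thesis
    by (simp add: V_def p_def[symmetric] apply_transition[of "\<lambda>y. (F y)\<^sup>2"] step_mean_fiber[symmetric])
      (simp add: power2_eq_square)
qed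

text \<open>Stationarity replaces the \<pi>-mean of F^2 by that of P(F^2), after which the one-step
  second moment can be read off.\<close>

lemma asymp_var_cv_eq:
  assumes "balanced \<pi> Q \<kappa>"
  shows "asymp_var_cv \<pi> Q \<kappa> F \<psi> =
    mean \<pi> (\<lambda>x. step_mean Q \<kappa> x (\<lambda>B y. (increment F \<psi> x B y)\<^sup>2))"
  unfolding step_mean_increment_square asymp_var_cv_def asymp_var_def
    stationary[OF assms, of "\<lambda>y. (F y)\<^sup>2", symmetric]
  by (simp add: mean_def ring_distribs sum.distrib sum_subtractf sum_distrib_left mult.assoc)

section \<open>Nonnegativity and minimality of the asymptotic variance\<close>

lemma variance_kappa_nonneg:
  assumes "x \<in> B"
  shows "0 \<le> variance_kappa \<kappa> x B g"
proof -
  define m where "m = (\<Sum>y\<in>B. \<kappa> x B y * g y)"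
  have "0 \<le> (\<Sum>y\<in>B. \<kappa> x B y * (g y - m)\<^sup>2)"
    by (intro sum_nonneg mult_nonneg_nonneg \<kappa>_nonneg assms) auto
  also have "\<dots> = (\<Sum>y\<in>B. \<kappa> x B y * (g y)\<^sup>2 - 2 * m * (\<kappa> x B y * g y) + m\<^sup>2 * \<kappa> x B y)"
    by (intro sum.cong refl) (simp add: power2_eq_square algebra_simps)
  also have "\<dots> = variance_kappa \<kappa> x B g"
    by (simp add: sum.distrib sum_subtractf \<kappa>_sum[OF assms] variance_kappa_def m_def[symmetric]
        flip: sum_distrib_left)
      (simp add: power2_eq_square)
  finally show ?thesis .
qed

lemma variance_kappa_zero: "variance_kappa \<kappa> x B (\<lambda>y. 0) = 0"
  by (simp add: variance_kappa_def)

lemma weighted_variance_nonneg: "0 \<le> Q x B * variance_kappa \<kappa> x B g"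
  using Q_nonneg Q_outside variance_kappa_nonneg by (cases "x \<in> B") auto

text \<open>The defining formula contains negative terms; the sign becomes visible in the form of a
  stationary second moment.\<close>

lemma asymp_var_cv_nonneg:
  assumes "positive_prob \<pi>" "balanced \<pi> Q \<kappa>"
  shows "0 \<le> asymp_var_cv \<pi> Q \<kappa> F \<psi>"
  unfolding asymp_var_cv_eq[OF assms(2)] mean_def step_mean_def using assms(1)
  by (auto intro!: sum_nonneg mult_nonneg_nonneg[OF _ sum_nonneg] mult_nonneg_nonneg[OF weight_nonneg]
      simp: positive_prob_def less_imp_le)

text \<open>For \<psi> = F the variance of \<psi> - F is that of the zero function; any other \<psi>
  contributes nonnegative weighted variances. The second claim holds because only the terms -Var(F)
  then remain.\<close>

lemma asymp_var_cv_minimal: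
  assumes "positive_prob \<pi>"
  shows "asymp_var_cv \<pi> Q \<kappa> F F \<le> asymp_var_cv \<pi> Q \<kappa> F \<psi>"
    and "asymp_var_cv \<pi> Q \<kappa> F F \<le> asymp_var \<pi> (transition Q \<kappa>) F"
proof -
  have \<pi>: "0 \<le> \<pi> x" for x using assms by (simp add: positive_prob_def less_imp_le)
  have "\<pi> x * Q x B * (0 - v) \<le> \<pi> x * Q x B * (variance_kappa \<kappa> x B g - v)" for x B g v
    using mult_nonneg_nonneg[OF \<pi> weighted_variance_nonneg, of x x B g] by (simp add: algebra_simps)
  then show "asymp_var_cv \<pi> Q \<kappa> F F \<le> asymp_var_cv \<pi> Q \<kappa> F \<psi>"
    unfolding asymp_var_cv_def by (simp only: diff_self variance_kappa_zero add_left_mono sum_mono)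
  have "\<pi> x * Q x B * (0 - variance_kappa \<kappa> x B F) \<le> 0" for x B
    using mult_nonneg_nonneg[OF \<pi> weighted_variance_nonneg, of x x B F] by (simp add: mult.assoc)
  then have "(\<Sum>x\<in>UNIV. \<Sum>B\<in>UNIV. \<pi> x * Q x B * (0 - variance_kappa \<kappa> x B F)) \<le> 0"
    by (intro sum_nonpos) auto
  then show "asymp_var_cv \<pi> Q \<kappa> F F \<le> asymp_var \<pi> (transition Q \<kappa>) F"
    unfolding asymp_var_cv_def by (simp add: variance_kappa_zero)
qed

end

subsection \<open>Moments and the strong law\<close>

text \<open>\<open>\<Phi> (T \<omega>)\<close> is a finite sum of indicators of level sets of
  \<open>T\<close>. Only these level sets must be events, so the value type of \<open>T\<close>
  carries no sigma-algebra.\<close>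

lemma (in prob_space) finite_valued_expectation:
  fixes \<Phi> :: "'c \<Rightarrow> 'b::{banach, second_countable_topology}"
  assumes S: "finite S" and T: "\<And>\<omega>. \<omega> \<in> space M \<Longrightarrow> T \<omega> \<in> S"
    and ev: "\<And>s. s \<in> S \<Longrightarrow> {\<omega> \<in> space M. T \<omega> = s} \<in> events"
  shows "integrable M (\<lambda>\<omega>. \<Phi> (T \<omega>))"
    and "expectation (\<lambda>\<omega>. \<Phi> (T \<omega>)) = (\<Sum>s\<in>S. prob {\<omega> \<in> space M. T \<omega> = s} *\<^sub>R \<Phi> s)"
proof -
  let ?E = "\<lambda>s. {\<omega> \<in> space M. T \<omega> = s}"
  have "has_bochner_integral M (\<lambda>\<omega>. \<Sum>s\<in>S. indicator (?E s) \<omega> *\<^sub>R \<Phi> s)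
      (\<Sum>s\<in>S. prob (?E s) *\<^sub>R \<Phi> s)"
    by (intro has_bochner_integral_sum has_bochner_integral_scaleR_left
        has_bochner_integral_real_indicator ev) (auto simp: emeasure_eq_measure)
  moreover have "(\<Sum>s\<in>S. indicator (?E s) \<omega> *\<^sub>R \<Phi> s) = \<Phi> (T \<omega>)" if "\<omega> \<in> space M" for \<omega>
  proof -
    have "(\<Sum>s\<in>S. indicator (?E s) \<omega> *\<^sub>R \<Phi> s) = (\<Sum>s\<in>S. if T \<omega> = s then \<Phi> s else 0)"
      using that by (intro sum.cong) auto
    then show ?thesis using S T[OF that] by simp
  qed
  ultimately have "has_bochner_integral M (\<lambda>\<omega>. \<Phi> (T \<omega>)) (\<Sum>s\<in>S. prob (?E s) *\<^sub>R \<Phi> s)"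
    by (simp cong: has_bochner_integral_cong)
  then show "integrable M (\<lambda>\<omega>. \<Phi> (T \<omega>))"
    "expectation (\<lambda>\<omega>. \<Phi> (T \<omega>)) = (\<Sum>s\<in>S. prob (?E s) *\<^sub>R \<Phi> s)"
    by (auto dest: has_bochner_integral_integrable has_bochner_integral_integral_eq
        intro: integrable.intros)
qed

section \<open>Histories of the chain and conditioning on them\<close>

locale sampled_chain = proposal_pair Q \<kappa> + prob_space M
  for Q :: "'a::finite \<Rightarrow> 'a set \<Rightarrow> real" and \<kappa> and M :: "'w measure" +
  fixes \<nu>\<^sub>0 :: "'a \<Rightarrow> real" and X :: "nat \<Rightarrow> 'w \<Rightarrow> 'a" and A :: "nat \<Rightarrow> 'w \<Rightarrow> 'a set"
  assumes chain: "proposal_chain M \<nu>\<^sub>0 Q \<kappa> X A"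
begin

lemma X_measurable [measurable]: "X n \<in> measurable M (count_space UNIV)"
  and A_measurable [measurable]: "A (Suc n) \<in> measurable M (count_space UNIV)"
  using chain by (auto simp: proposal_chain_def)

text \<open>Restriction to the index ranges leaves finitely many possible histories, so expectations
  become finite sums. Proposal sets are recorded from index 1 on, the first one being
  \<open>A 1\<close>.\<close>

definition hist :: "nat \<Rightarrow> 'w \<Rightarrow> (nat \<Rightarrow> 'a) \<times> (nat \<Rightarrow> 'a set)" where
  "hist n \<omega> = (restrict (\<lambda>k. X k \<omega>) {..n}, restrict (\<lambda>k. A k \<omega>) {1..n})"

definition hists :: "nat \<Rightarrow> ((nat \<Rightarrow> 'a) \<times> (nat \<Rightarrow> 'a set)) set" where
  "hists n = ({..n} \<rightarrow>\<^sub>E UNIV) \<times> ({1..n} \<rightarrow>\<^sub>E UNIV)"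

lemma finite_hists: "finite (hists n)"
  by (auto simp: hists_def intro!: finite_PiE)

lemma hist_in_hists: "hist n \<omega> \<in> hists n"
  by (auto simp: hist_def hists_def)

text \<open>Membership in \<open>hists n\<close> fixes the value \<open>undefined\<close> outside
  the index ranges, so agreement on the ranges gives equality of the pairs.\<close>

lemma hist_eq_iff:
  assumes "l \<in> hists n"
  shows "hist n \<omega> = l \<longleftrightarrow> past X A (fst l) (snd l) n \<omega>"
proof
  assume "past X A (fst l) (snd l) n \<omega>"
  then have "fst (hist n \<omega>) k = fst l k" "snd (hist n \<omega>) k = snd l k" for k
    using assms by (auto simp: hist_def hists_def past_def PiE_def extensional_def restrict_def)
  then have "fst (hist n \<omega>) = fst l" "snd (hist n \<omega>) = snd l" by blast+
  then show "hist n \<omega> = l" by (rule prod_eqI)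
qed (auto simp: hist_def past_def)

lemma past_event: "{\<omega> \<in> space M. past X A x a n \<omega>} \<in> events"
proof -
  have [measurable]: "A k \<in> measurable M (count_space UNIV)" if "k \<in> {1..n}" for k
    using that A_measurable[of "k - 1"] by simp
  show ?thesis unfolding past_def by measurable
qed

lemma past_event_A: "{\<omega> \<in> space M. past X A x a n \<omega> \<and> A (Suc n) \<omega> = B} \<in> events"
proof -
  note past_event[measurable]
  show ?thesis by measurable
qed

lemma past_event_step:
  "{\<omega> \<in> space M. past X A x a n \<omega> \<and> A (Suc n) \<omega> = B \<and> X (Suc n) \<omega> = y} \<in> events"
proof -
  note past_event[measurable]
  show ?thesis by measurable
qed

text \<open>The product form of the conditional law also covers a null past, where that law is
  unspecified but both sides are 0.\<close>

lemma prob_step_A: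
  "prob {\<omega> \<in> space M. past X A x a n \<omega> \<and> A (Suc n) \<omega> = B} =
    prob {\<omega> \<in> space M. past X A x a n \<omega>} * Q (x n) B"
proof (cases "prob {\<omega> \<in> space M. past X A x a n \<omega>} > 0")
  case True
  then have "cond_prob M (\<lambda>\<omega>. A (Suc n) \<omega> = B) (past X A x a n) = Q (x n) B"
    using chain by (auto simp: proposal_chain_def)
  then show ?thesis using True by (simp add: cond_prob_def field_simps conj_commute)
next
  case False
  then have "prob {\<omega> \<in> space M. past X A x a n \<omega>} = 0"
    by (metis measure_nonneg order_le_less)
  moreover have "prob {\<omega> \<in> space M. past X A x a n \<omega> \<and> A (Suc n) \<omega> = B} \<le>
      prob {\<omega> \<in> space M. past X A x a n \<omega>}"
    by (rule finite_measure_mono[OF _ past_event]) auto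
  ultimately show ?thesis by (simp add: measure_le_0_iff)
qed

lemma prob_step_member:
  assumes "y \<in> B"
  shows "prob {\<omega> \<in> space M. past X A x a n \<omega> \<and> A (Suc n) \<omega> = B \<and> X (Suc n) \<omega> = y} =
    prob {\<omega> \<in> space M. past X A x a n \<omega>} * (Q (x n) B * \<kappa> (x n) B y)"
proof (cases "prob {\<omega> \<in> space M. past X A x a n \<omega> \<and> A (Suc n) \<omega> = B} > 0")
  case True
  then have "cond_prob M (\<lambda>\<omega>. X (Suc n) \<omega> = y) (\<lambda>\<omega>. past X A x a n \<omega> \<and> A (Suc n) \<omega> = B) =
      \<kappa> (x n) B y"
    using chain assms by (auto simp: proposal_chain_def)
  then have "prob {\<omega> \<in> space M. past X A x a n \<omega> \<and> A (Suc n) \<omega> = B \<and> X (Suc n) \<omega> = y} =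
      prob {\<omega> \<in> space M. past X A x a n \<omega> \<and> A (Suc n) \<omega> = B} * \<kappa> (x n) B y"
    using True by (simp add: cond_prob_def field_simps conj_ac)
  then show ?thesis by (simp add: prob_step_A)
next
  case False
  then have 0: "prob {\<omega> \<in> space M. past X A x a n \<omega> \<and> A (Suc n) \<omega> = B} = 0"
    by (metis measure_nonneg order_le_less)
  moreover have "prob {\<omega> \<in> space M. past X A x a n \<omega> \<and> A (Suc n) \<omega> = B \<and> X (Suc n) \<omega> = y} \<le>
      prob {\<omega> \<in> space M. past X A x a n \<omega> \<and> A (Suc n) \<omega> = B}"
    by (rule finite_measure_mono[OF _ past_event_A]) auto
  ultimately have "prob {\<omega> \<in> space M. past X A x a n \<omega> \<and> A (Suc n) \<omega> = B \<and> X (Suc n) \<omega> = y} = 0"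
    by (simp only: measure_le_0_iff)
  \<comment> \<open>With a null conditioning event the law of the next state is unspecified; the
    right-hand side vanishes too, because its factor is the probability of that event.\<close>
  moreover have "prob {\<omega> \<in> space M. past X A x a n \<omega>} * Q (x n) B = 0"
    using 0 prob_step_A[of x a n B] by metis
  then have "prob {\<omega> \<in> space M. past X A x a n \<omega>} * (Q (x n) B * \<kappa> (x n) B y) = 0"
    by auto
  ultimately show ?thesis by metis
qed

text \<open>The chain is only specified on \<open>y \<in> B\<close>; those \<open>y\<close> already carry the whole mass.\<close>
lemma prob_step:
  "prob {\<omega> \<in> space M. past X A x a n \<omega> \<and> A (Suc n) \<omega> = B \<and> X (Suc n) \<omega> = y} =
    prob {\<omega> \<in> space M. past X A x a n \<omega>} * (if y \<in> B then Q (x n) B * \<kappa> (x n) B y else 0)"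
proof (cases "y \<in> B")
  case False
  let ?E = "\<lambda>y. {\<omega> \<in> space M. past X A x a n \<omega> \<and> A (Suc n) \<omega> = B \<and> X (Suc n) \<omega> = y}"
  let ?EB = "{\<omega> \<in> space M. past X A x a n \<omega> \<and> A (Suc n) \<omega> = B}"
  have "prob ?EB = prob (\<Union>z. ?E z)" by (rule arg_cong[of _ _ prob]) auto
  also have "\<dots> = (\<Sum>z\<in>UNIV. prob (?E z))"
    by (rule finite_measure_finite_Union) (auto simp: disjoint_family_on_def past_event_step)
  also have "\<dots> = (\<Sum>z\<in>B. prob (?E z)) + (\<Sum>z\<in>-B. prob (?E z))"
    using sum.subset_diff[of B UNIV "\<lambda>z. prob (?E z)"] by (simp add: Compl_eq_Diff_UNIV)
  also have "(\<Sum>z\<in>B. prob (?E z)) = prob ?EB"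
    using weight_sum[where B = B and x = "x n"]
    by (simp add: prob_step_member prob_step_A flip: sum_distrib_left)
  finally have "(\<Sum>z\<in>-B. prob (?E z)) = 0" by simp
  then have "prob (?E y) = 0" using False by (simp add: sum_nonneg_eq_0_iff)
  then show ?thesis using False by simp
qed (simp add: prob_step_member)

lemma hist_integrable:
  fixes G :: "_ \<Rightarrow> 'b::{banach, second_countable_topology}"
  shows "integrable M (\<lambda>\<omega>. G (hist n \<omega>))"
  by (rule finite_valued_expectation(1)[OF finite_hists hist_in_hists])
    (simp add: hist_eq_iff past_event)

text \<open>The Markov property for functionals of the whole history: both sides are expanded over
  the finitely many values of history, next proposal set and next state, and
  \<open>prob_step\<close> supplies the joint weights.\<close>

lemma step_expectation:
  fixes G :: "_ \<Rightarrow> 'b::{real_normed_field, banach, second_countable_topology}"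
  shows "expectation (\<lambda>\<omega>. G (hist n \<omega>) * \<phi> (X n \<omega>) (A (Suc n) \<omega>) (X (Suc n) \<omega>)) =
    expectation (\<lambda>\<omega>. G (hist n \<omega>) * step_mean Q \<kappa> (X n \<omega>) (\<phi> (X n \<omega>)))"
proof -
  let ?p = "\<lambda>l. prob {\<omega> \<in> space M. hist n \<omega> = l}"
  have X: "X n \<omega> = fst (hist n \<omega>) n" for \<omega> by (simp add: hist_def)
  have ev: "{\<omega> \<in> space M. (hist n \<omega>, A (Suc n) \<omega>, X (Suc n) \<omega>) = s} =
     {\<omega> \<in> space M. past X A (fst (fst s)) (snd (fst s)) n \<omega> \<and>
        A (Suc n) \<omega> = fst (snd s) \<and> X (Suc n) \<omega> = snd (snd s)}"
    if "s \<in> hists n \<times> UNIV \<times> UNIV" for s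
    using that by (cases s) (auto simp: hist_eq_iff)
  have fin: "finite (hists n \<times> (UNIV :: 'a set set) \<times> (UNIV :: 'a set))"
    by (simp add: finite_hists)
  have "expectation (\<lambda>\<omega>. G (hist n \<omega>) * \<phi> (X n \<omega>) (A (Suc n) \<omega>) (X (Suc n) \<omega>)) =
    expectation (\<lambda>\<omega>. (\<lambda>(l, B, y). G l * \<phi> (fst l n) B y) (hist n \<omega>, A (Suc n) \<omega>, X (Suc n) \<omega>))"
    by (simp add: X)
  also have "\<dots> = (\<Sum>s\<in>hists n \<times> UNIV \<times> UNIV.
      prob {\<omega> \<in> space M. (hist n \<omega>, A (Suc n) \<omega>, X (Suc n) \<omega>) = s} *\<^sub>R
        (case s of (l, B, y) \<Rightarrow> G l * \<phi> (fst l n) B y))"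
    by (rule finite_valued_expectation(2)[OF fin])
      (simp_all only: ev past_event_step, simp add: hist_in_hists)
  also have "\<dots> = (\<Sum>s\<in>hists n \<times> UNIV \<times> UNIV.
      case s of (l, B, y) \<Rightarrow> (?p l * (if y \<in> B then Q (fst l n) B * \<kappa> (fst l n) B y else 0)) *\<^sub>R
        (G l * \<phi> (fst l n) B y))"
    by (intro sum.cong refl, simp only: ev prob_step) (auto simp: hist_eq_iff split: prod.splits)
  also have "\<dots> = (\<Sum>l\<in>hists n. \<Sum>B\<in>UNIV. \<Sum>y\<in>UNIV.
      (?p l * (if y \<in> B then Q (fst l n) B * \<kappa> (fst l n) B y else 0)) *\<^sub>R (G l * \<phi> (fst l n) B y))"
    by (simp add: sum.cartesian_product)
  also have "\<dots> = (\<Sum>l\<in>hists n. ?p l *\<^sub>R (G l * step_mean Q \<kappa> (fst l n) (\<phi> (fst l n))))"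
    by (simp add: step_mean_def scaleR_sum_right sum_distrib_left if_distrib[of "\<lambda>c. _ * c"]
        if_distrib[of "\<lambda>c. c *\<^sub>R _"] sum.If_cases cong: if_cong)
  also have "\<dots> = expectation (\<lambda>\<omega>. (\<lambda>l. G l * step_mean Q \<kappa> (fst l n) (\<phi> (fst l n))) (hist n \<omega>))"
    by (rule finite_valued_expectation(2)[OF finite_hists hist_in_hists, symmetric])
      (simp add: hist_eq_iff past_event)
  finally show ?thesis by (simp add: X)
qed

section \<open>Path sums, their moments and their almost sure behaviour\<close>

definition path_sum :: "('a \<Rightarrow> 'a set \<Rightarrow> 'a \<Rightarrow> real) \<Rightarrow> nat \<Rightarrow> 'w \<Rightarrow> real" where
  "path_sum g n \<omega> = (\<Sum>k<n. g (X k \<omega>) (A (Suc k) \<omega>) (X (Suc k) \<omega>))"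

text \<open>The path sum as a function of a recorded history, the form to which
  \<open>step_expectation\<close> applies.\<close>

definition hist_sum :: "('a \<Rightarrow> 'a set \<Rightarrow> 'a \<Rightarrow> real) \<Rightarrow> nat \<Rightarrow> (nat \<Rightarrow> 'a) \<times> (nat \<Rightarrow> 'a set) \<Rightarrow> real" where
  "hist_sum g n l = (\<Sum>k<n. g (fst l k) (snd l (Suc k)) (fst l (Suc k)))"

lemma path_sum_hist: "path_sum g n \<omega> = hist_sum g n (hist n \<omega>)"
  by (auto simp: path_sum_def hist_sum_def hist_def intro!: sum.cong)

lemma path_sum_Suc:
  "path_sum g (Suc n) \<omega> = path_sum g n \<omega> + g (X n \<omega>) (A (Suc n) \<omega>) (X (Suc n) \<omega>)"
  by (simp add: path_sum_def)

text \<open>All arguments are functions of \<open>hist (Suc n)\<close>, which takes finitely many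
  values; the sum up to \<open>n\<close> reads the same entries there as in
  \<open>hist n\<close>.\<close>

lemma path_step_integrable:
  fixes h :: "real \<Rightarrow> 'a \<Rightarrow> 'a set \<Rightarrow> 'a \<Rightarrow> 'b::{banach, second_countable_topology}"
  shows "integrable M (\<lambda>\<omega>. h (path_sum g n \<omega>) (X n \<omega>) (A (Suc n) \<omega>) (X (Suc n) \<omega>))"
proof -
  have "hist_sum g n (hist (Suc n) \<omega>) = hist_sum g n (hist n \<omega>)" for \<omega>
    by (auto simp: hist_sum_def hist_def intro!: sum.cong)
  then have "(\<lambda>\<omega>. h (path_sum g n \<omega>) (X n \<omega>) (A (Suc n) \<omega>) (X (Suc n) \<omega>)) =
      (\<lambda>\<omega>. (\<lambda>l. h (hist_sum g n l) (fst l n) (snd l (Suc n)) (fst l (Suc n))) (hist (Suc n) \<omega>))"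
    by (simp add: path_sum_hist) (simp add: hist_def)
  then show ?thesis
    using hist_integrable[of "\<lambda>l. h (hist_sum g n l) (fst l n) (snd l (Suc n)) (fst l (Suc n))" "Suc n"]
    by simp
qed

lemma path_integrable:
  fixes h :: "real \<Rightarrow> 'a \<Rightarrow> 'b::{banach, second_countable_topology}"
  shows "integrable M (\<lambda>\<omega>. h (path_sum g n \<omega>) (X n \<omega>))"
  using path_step_integrable[of "\<lambda>s x B y. h s x"] by simp

lemma path_step_expectation:
  fixes h :: "real \<Rightarrow> 'a \<Rightarrow> 'b::{real_normed_field, banach, second_countable_topology}"
  shows "expectation (\<lambda>\<omega>. h (path_sum g n \<omega>) (X n \<omega>) * \<phi> (X n \<omega>) (A (Suc n) \<omega>) (X (Suc n) \<omega>)) =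
    expectation (\<lambda>\<omega>. h (path_sum g n \<omega>) (X n \<omega>) * step_mean Q \<kappa> (X n \<omega>) (\<phi> (X n \<omega>)))"
proof -
  have "X n \<omega> = fst (hist n \<omega>) n" for \<omega> by (simp add: hist_def)
  then have "(\<lambda>\<omega>. h (path_sum g n \<omega>) (X n \<omega>)) = (\<lambda>\<omega>. (\<lambda>l. h (hist_sum g n l) (fst l n)) (hist n \<omega>))"
    by (simp add: path_sum_hist)
  then have "h (path_sum g n \<omega>) (X n \<omega>) = (\<lambda>l. h (hist_sum g n l) (fst l n)) (hist n \<omega>)" for \<omega>
    by metis
  then show ?thesis
    by (simp only: step_expectation[of "\<lambda>l. h (hist_sum g n l) (fst l n)"])
qed

lemma path_sum_measurable [measurable]: "path_sum g n \<in> borel_measurable M"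
  using path_integrable[of "\<lambda>s x. s" g n] by (simp add: integrable_iff_bounded)

context
  fixes g :: "'a \<Rightarrow> 'a set \<Rightarrow> 'a \<Rightarrow> real" and K :: real
  assumes centred: "\<And>x. step_mean Q \<kappa> x (g x) = 0" and bound: "\<And>x B y. \<bar>g x B y\<bar> \<le> K"
begin

text \<open>The cross term vanishes since increments are centred given the past, so each step adds
  at most \<open>K\<^sup>2\<close>.\<close>

lemma second_moment_le: "expectation (\<lambda>\<omega>. (path_sum g n \<omega>)\<^sup>2) \<le> K\<^sup>2 * n"
proof (induction n)
  case (Suc n)
  let ?S = "path_sum g n" and ?D = "\<lambda>\<omega>. g (X n \<omega>) (A (Suc n) \<omega>) (X (Suc n) \<omega>)"
  have sq: "(?D \<omega>)\<^sup>2 \<le> K\<^sup>2" for \<omega> using bound by (metis abs_ge_zero power2_abs power_mono)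
  have "expectation (\<lambda>\<omega>. (path_sum g (Suc n) \<omega>)\<^sup>2) \<le>
      expectation (\<lambda>\<omega>. ((?S \<omega>)\<^sup>2 + 2 * ?S \<omega> * ?D \<omega>) + K\<^sup>2)"
    unfolding path_sum_Suc
  proof (rule integral_mono)
    show "integrable M (\<lambda>\<omega>. (?S \<omega> + ?D \<omega>)\<^sup>2)"
      by (rule path_step_integrable[of "\<lambda>s x B y. (s + g x B y)\<^sup>2"])
    show "integrable M (\<lambda>\<omega>. ((?S \<omega>)\<^sup>2 + 2 * ?S \<omega> * ?D \<omega>) + K\<^sup>2)"
      by (rule path_step_integrable[of "\<lambda>s x B y. (s\<^sup>2 + 2 * s * g x B y) + K\<^sup>2"])
    show "(?S \<omega> + ?D \<omega>)\<^sup>2 \<le> ((?S \<omega>)\<^sup>2 + 2 * ?S \<omega> * ?D \<omega>) + K\<^sup>2" for \<omega>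
      using sq[of \<omega>] by (simp add: power2_sum)
  qed
  also have "\<dots> = expectation (\<lambda>\<omega>. (?S \<omega>)\<^sup>2) + expectation (\<lambda>\<omega>. 2 * ?S \<omega> * ?D \<omega>) + K\<^sup>2"
    using path_step_integrable[of "\<lambda>s x B y. s\<^sup>2" g n]
      path_step_integrable[of "\<lambda>s x B y. 2 * s * g x B y" g n]
    by (simp add: prob_space)
  also have "expectation (\<lambda>\<omega>. 2 * ?S \<omega> * ?D \<omega>) = 0"
    using path_step_expectation[of "\<lambda>s x. 2 * s" g n g] by (simp add: centred)
  finally show ?case using Suc.IH by (simp add: algebra_simps)
qed (simp add: path_sum_def)

text \<open>In the expansion of the fourth power the term linear in the increment has mean 0, and
  the quadratic one is controlled by the second moment; the bound thus grows by O(n) per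
  step.\<close>

lemma fourth_moment_le: "expectation (\<lambda>\<omega>. (path_sum g n \<omega>) ^ 4) \<le> 11 * K ^ 4 * (real n)\<^sup>2"
proof (induction n)
  case (Suc n)
  let ?S = "path_sum g n" and ?D = "\<lambda>\<omega>. g (X n \<omega>) (A (Suc n) \<omega>) (X (Suc n) \<omega>)"
  have ptw: "(s + d) ^ 4 \<le> s ^ 4 + 4 * s ^ 3 * d + 8 * K\<^sup>2 * s\<^sup>2 + 3 * K ^ 4" if "\<bar>d\<bar> \<le> K" for s d :: real
  proof -
    have d2: "d\<^sup>2 \<le> K\<^sup>2" using that by (metis abs_ge_zero power2_abs power_mono)
    have "d ^ 4 = (d\<^sup>2)\<^sup>2" "K ^ 4 = (K\<^sup>2)\<^sup>2" by simp_all
    then have d4: "d ^ 4 \<le> K ^ 4" using d2 by (metis power_mono zero_le_power2)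
    have "8 * (s\<^sup>2 * d\<^sup>2) \<le> 8 * K\<^sup>2 * s\<^sup>2" using d2 mult_right_mono[OF d2, of "s\<^sup>2"] by (simp add: mult_ac)
    \<comment> \<open>Completing a square absorbs the term 4 s d^3, whose sign is unknown.\<close>
    moreover have "(s + d) ^ 4 = s ^ 4 + 4 * s ^ 3 * d + 8 * (s\<^sup>2 * d\<^sup>2) + 3 * d ^ 4 - 2 * (d * (s - d))\<^sup>2"
      by (simp add: power2_eq_square power3_eq_cube power4_eq_xxxx algebra_simps)
    ultimately show ?thesis using d4 zero_le_power2[of "d * (s - d)"] by linarith
  qed
  have "expectation (\<lambda>\<omega>. (path_sum g (Suc n) \<omega>) ^ 4) \<le>
      expectation (\<lambda>\<omega>. ?S \<omega> ^ 4 + 4 * ?S \<omega> ^ 3 * ?D \<omega> + 8 * K\<^sup>2 * (?S \<omega>)\<^sup>2 + 3 * K ^ 4)"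
    unfolding path_sum_Suc
    by (rule integral_mono[OF path_step_integrable[of "\<lambda>s x B y. (s + g x B y) ^ 4"]
          path_step_integrable[of "\<lambda>s x B y. s ^ 4 + 4 * s ^ 3 * g x B y + 8 * K\<^sup>2 * s\<^sup>2 + 3 * K ^ 4"]])
      (rule ptw[OF bound])
  also have "\<dots> = expectation (\<lambda>\<omega>. ?S \<omega> ^ 4) + expectation (\<lambda>\<omega>. 4 * ?S \<omega> ^ 3 * ?D \<omega>) +
      8 * K\<^sup>2 * expectation (\<lambda>\<omega>. (?S \<omega>)\<^sup>2) + 3 * K ^ 4"
    using path_step_integrable[of "\<lambda>s x B y. s ^ 4" g n]
      path_step_integrable[of "\<lambda>s x B y. 4 * s ^ 3 * g x B y" g n]
      path_step_integrable[of "\<lambda>s x B y. s\<^sup>2" g n]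
    by (simp add: prob_space)
  also have "expectation (\<lambda>\<omega>. 4 * ?S \<omega> ^ 3 * ?D \<omega>) = 0"
    using path_step_expectation[of "\<lambda>s x. 4 * s ^ 3" g n g] by (simp add: centred)
  also have "8 * K\<^sup>2 * expectation (\<lambda>\<omega>. (?S \<omega>)\<^sup>2) \<le> 8 * K\<^sup>2 * (K\<^sup>2 * n)"
    by (intro mult_left_mono second_moment_le) auto
  also have "8 * K\<^sup>2 * (K\<^sup>2 * n) = 8 * K ^ 4 * n"
    by (simp add: power2_eq_square power4_eq_xxxx)
  finally have "expectation (\<lambda>\<omega>. (path_sum g (Suc n) \<omega>) ^ 4) \<le>
      11 * K ^ 4 * (real n)\<^sup>2 + 8 * K ^ 4 * n + 3 * K ^ 4"
    using Suc.IH by simp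
  \<comment> \<open>The comparisons 8 \<le> 22 and 3 \<le> 11 complete 11 n^2 to 11 (n +
    1)^2.\<close>
  also have "\<dots> \<le> 11 * K ^ 4 * (real n)\<^sup>2 + 22 * K ^ 4 * n + 11 * K ^ 4"
    by (intro add_mono mult_right_mono) auto
  also have "\<dots> = 11 * K ^ 4 * (real (Suc n))\<^sup>2"
    by (simp add: power2_eq_square algebra_simps)
  finally show ?case .
qed (simp add: path_sum_def)

text \<open>The fourth moments of S_n / n are O(n^(-2)), hence summable. The series of fourth powers
  therefore has finite expectation, converges almost surely, and its terms tend to 0.\<close>

lemma path_sum_strong_law: "AE \<omega> in M. (\<lambda>n. path_sum g n \<omega> / n) \<longlonglongrightarrow> 0"
proof -
  let ?Y = "\<lambda>n \<omega>. (path_sum g n \<omega> / real n) ^ 4"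
  have Y: "(\<integral>\<^sup>+\<omega>. ennreal (?Y n \<omega>) \<partial>M) \<le> ennreal (11 * K ^ 4 * inverse ((real n)\<^sup>2))" for n
  proof -
    have "(\<integral>\<^sup>+\<omega>. ennreal (?Y n \<omega>) \<partial>M) = ennreal (expectation (?Y n))"
      by (rule nn_integral_eq_integral[OF path_integrable[of "\<lambda>s x. (s / real n) ^ 4"]]) simp
    also have "expectation (?Y n) = expectation (\<lambda>\<omega>. (path_sum g n \<omega>) ^ 4) / real n ^ 4"
      by (simp add: power_divide)
    also have "\<dots> \<le> (11 * K ^ 4 * (real n)\<^sup>2) / real n ^ 4"
      by (intro divide_right_mono fourth_moment_le) simp
    also have "\<dots> = 11 * K ^ 4 * inverse ((real n)\<^sup>2)"
      \<comment> \<open>At \<open>n = 0\<close> both sides are 0, by the conventions for division by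
        zero and \<open>inverse 0\<close>.\<close>
      by (cases "n = 0") (auto simp: field_simps power2_eq_square power4_eq_xxxx)
    finally show ?thesis by (simp add: ennreal_leI)
  qed
  have summable: "summable (\<lambda>n. 11 * K ^ 4 * inverse ((real n)\<^sup>2))"
    by (intro summable_mult inverse_power_summable) simp
  have "(\<integral>\<^sup>+\<omega>. (\<Sum>n. ennreal (?Y n \<omega>)) \<partial>M) = (\<Sum>n. \<integral>\<^sup>+\<omega>. ennreal (?Y n \<omega>) \<partial>M)"
    by (rule nn_integral_suminf) measurable
  also have "\<dots> \<le> (\<Sum>n. ennreal (11 * K ^ 4 * inverse ((real n)\<^sup>2)))"
    by (intro suminf_le Y) auto
  also have "\<dots> = ennreal (\<Sum>n. 11 * K ^ 4 * inverse ((real n)\<^sup>2))"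
    by (intro suminf_ennreal2 summable) auto
  also have "\<dots> < \<infinity>" by simp
  finally have "AE \<omega> in M. (\<Sum>n. ennreal (?Y n \<omega>)) \<noteq> \<infinity>"
    by (intro nn_integral_noteq_infinite) auto
  then show ?thesis
  proof eventually_elim
    case (elim \<omega>)
    then have "summable (\<lambda>n. ?Y n \<omega>)"
      by (intro summable_suminf_not_top) auto
    then have "(\<lambda>n. ?Y n \<omega>) \<longlonglongrightarrow> 0" by (rule summable_LIMSEQ_zero)
    then show ?case by simp
  qed
qed

end

end

subsection \<open>Characteristic functions\<close>

lemma (in prob_space) norm_expectation_le:
  fixes Y :: "'a \<Rightarrow> 'b::{banach, second_countable_topology}"
  assumes "integrable M Y" "\<And>\<omega>. norm (Y \<omega>) \<le> c"
  shows "norm (expectation Y) \<le> c"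
proof -
  have "norm (expectation Y) \<le> expectation (\<lambda>\<omega>. norm (Y \<omega>))" by (rule integral_norm_bound)
  also have "\<dots> \<le> expectation (\<lambda>_. c)"
    using assms by (intro integral_mono) auto
  finally show ?thesis by (simp add: prob_space)
qed

lemma norm_iexp_minus_one_le: "norm (iexp u - 1) \<le> \<bar>u\<bar>"
  using iexp_approx1[of u 0] by simp

lemma norm_iexp_diff_le: "norm (iexp u - iexp v) \<le> \<bar>u - v\<bar>"
proof -
  have "iexp u - iexp v = iexp v * (iexp (u - v) - 1)"
    by (simp add: algebra_simps flip: exp_add)
  then have "norm (iexp u - iexp v) = norm (iexp (u - v) - 1)"
    by (simp add: norm_mult)
  then show ?thesis using norm_iexp_minus_one_le[of "u - v"] by simp
qed

lemma real_distribution_normal_law: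
  assumes "0 \<le> v"
  shows "real_distribution (normal_law m v)"
proof (cases "v = 0")
  case True
  then show ?thesis
    by (simp add: normal_law_def real_distribution_def real_distribution_axioms_def prob_space_return)
next
  case False
  then show ?thesis using assms
    by (simp add: normal_law_def real_distribution_def real_distribution_axioms_def
        prob_space_normal_density)
qed

text \<open>For positive \<open>v\<close> the law is the image of the standard normal under
  multiplication by \<open>sqrt v\<close>; for \<open>v = 0\<close> it is the Dirac mass at
  0.\<close>

lemma char_normal_law:
  assumes "0 \<le> v"
  shows "char (normal_law 0 v) t = exp (- (v * t\<^sup>2) / 2)"
proof (cases "v = 0")
  case True
  then show ?thesis by (simp add: normal_law_def char_def integral_return)
next
  case False
  then have v: "0 < sqrt v" using assms by simp
  interpret N: real_distribution std_normal_distribution by (rule real_dist_normal_dist)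
  have "distributed std_normal_distribution lborel (\<lambda>x. x) std_normal_density"
    by (simp add: distributed_def distr_id2)
  from N.normal_density_affine[OF this, of "sqrt v" 0]
  have "distributed std_normal_distribution lborel (\<lambda>x. sqrt v * x) (normal_density 0 (sqrt v))"
    using v by simp
  then have "density lborel (normal_density 0 (sqrt v)) =
      distr std_normal_distribution lborel (\<lambda>x. sqrt v * x)"
    by (simp add: distributed_def)
  then have "char (normal_law 0 v) t = char std_normal_distribution (t * sqrt v)"
    using False by (simp add: normal_law_def char_def integral_distr mult.assoc)
  also have "\<dots> = exp (- (t * sqrt v)\<^sup>2 / 2)"
    by (simp add: char_std_normal_distribution)
  finally show ?thesis using assms by (simp add: power_mult_distrib mult.commute)
qed

lemma finite_function_bounded:
  fixes h :: "'b::finite \<Rightarrow> real"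
  shows "\<exists>c. \<forall>x. \<bar>h x\<bar> \<le> c"
proof (intro exI allI)
  show "\<bar>h x\<bar> \<le> Max (range (\<lambda>x. \<bar>h x\<bar>))" for x by (rule Max_ge) auto
qed

section \<open>Transforms of a centred path sum and its central limit theorem\<close>

context sampled_chain
begin

context
  fixes g :: "'a \<Rightarrow> 'a set \<Rightarrow> 'a \<Rightarrow> real" and H :: "'a \<Rightarrow> real" and s K L :: real
  assumes centred: "\<And>x. step_mean Q \<kappa> x (g x) = 0" and g_bound: "\<And>x B y. \<bar>g x B y\<bar> \<le> K"
    and H_bound: "\<And>x. \<bar>H x\<bar> \<le> L" and s_nonneg: "0 \<le> s"
    and corrector: "\<And>x. H x - apply_matrix (transition Q \<kappa>) H x =
      step_mean Q \<kappa> x (\<lambda>B y. (g x B y)\<^sup>2) - s"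
begin

text \<open>The weight \<open>1 - \<theta>\<^sup>2 H / 2\<close> replaces the conditional variance of an increment, which depends on
  the state, by its stationary mean \<open>s\<close>.\<close>
definition tilt :: "real \<Rightarrow> 'a \<Rightarrow> complex" where
  "tilt \<theta> x = complex_of_real (1 - \<theta>\<^sup>2 / 2 * H x)"

lemma norm_tilt_minus_one_le: "norm (tilt \<theta> x - 1) \<le> \<theta>\<^sup>2 / 2 * L"
proof -
  have "tilt \<theta> x - 1 = complex_of_real (- (\<theta>\<^sup>2 / 2 * H x))" by (simp add: tilt_def)
  then have "norm (tilt \<theta> x - 1) = \<theta>\<^sup>2 / 2 * \<bar>H x\<bar>"
    by (simp only: norm_of_real abs_minus_cancel abs_mult) simp
  also have "\<dots> \<le> \<theta>\<^sup>2 / 2 * L" using H_bound by (intro mult_left_mono) auto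
  finally show ?thesis .
qed

text \<open>The second-order expansion \<open>T\<close> has mean 1 - \<theta>^2 (s + H x) / 2 by the
  corrector equation, which factors up to order \<theta>^4. The three constants come from the Taylor
  remainder, the product of first-order errors, and this factorisation.\<close>

lemma one_step_estimate:
  assumes \<theta>: "\<bar>\<theta>\<bar> \<le> 1"
  shows "norm (step_mean Q \<kappa> x (\<lambda>B y. iexp (\<theta> * g x B y) * tilt \<theta> y) -
      complex_of_real (1 - \<theta>\<^sup>2 * s / 2) * tilt \<theta> x) \<le> (K ^ 3 / 6 + L * K / 2 + s * L / 4) * \<bar>\<theta>\<bar> ^ 3"
proof -
  let ?P = "apply_matrix (transition Q \<kappa>) H x"
  have K: "0 \<le> K" and L: "0 \<le> L" using g_bound[of x "{}" x] H_bound[of x] by auto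
  define T where "T B y = complex_of_real (1 - \<theta>\<^sup>2 / 2 * ((g x B y)\<^sup>2 + H y)) + \<i> * \<theta> * complex_of_real (g x B y)"
    for B y
  have "step_mean Q \<kappa> x T =
      complex_of_real (step_mean Q \<kappa> x (\<lambda>B y. 1 - \<theta>\<^sup>2 / 2 * ((g x B y)\<^sup>2 + H y))) +
      \<i> * \<theta> * complex_of_real (step_mean Q \<kappa> x (g x))"
    unfolding T_def by (simp only: step_mean_add step_mean_mult step_mean_of_real)
  also have "step_mean Q \<kappa> x (\<lambda>B y. 1 - \<theta>\<^sup>2 / 2 * ((g x B y)\<^sup>2 + H y)) =
      1 - \<theta>\<^sup>2 / 2 * (step_mean Q \<kappa> x (\<lambda>B y. (g x B y)\<^sup>2) + ?P)"
    by (simp only: step_mean_add step_mean_mult step_mean_diff step_mean_const apply_transition)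
  also have "step_mean Q \<kappa> x (\<lambda>B y. (g x B y)\<^sup>2) + ?P = s + H x"
    using corrector[of x] by simp
  finally have T: "step_mean Q \<kappa> x T = complex_of_real (1 - \<theta>\<^sup>2 / 2 * (s + H x))"
    by (simp add: centred)
  have err: "norm (iexp (\<theta> * g x B y) * tilt \<theta> y - T B y) \<le> (K ^ 3 / 6 + L * K / 2) * \<bar>\<theta>\<bar> ^ 3" for B y
  proof -
    define u where "u = \<theta> * g x B y"
    have u: "\<bar>u\<bar> \<le> \<bar>\<theta>\<bar> * K" by (simp add: u_def abs_mult mult_left_mono g_bound)
    \<comment> \<open>\<open>T\<close> is the quadratic Taylor polynomial of the exponential plus
      \<open>tilt \<theta> y - 1\<close>; what is left is the remainder and a product of two small
      factors.\<close>
    have "iexp u * tilt \<theta> y - T B y =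
        (iexp u - (\<Sum>k\<le>2. (\<i> * u) ^ k / fact k)) + (tilt \<theta> y - 1) * (iexp u - 1)"
      by (simp add: T_def tilt_def u_def numeral_2_eq_2 power_mult_distrib field_simps)
    also have "norm \<dots> \<le> \<bar>u\<bar> ^ 3 / 6 + (\<theta>\<^sup>2 / 2 * L) * \<bar>u\<bar>"
    proof (intro order.trans[OF norm_triangle_ineq] add_mono)
      have "fact 3 = (6::real)" "Suc 2 = 3" by (simp_all add: fact_numeral)
      then show "norm (iexp u - (\<Sum>k\<le>2. (\<i> * u) ^ k / fact k)) \<le> \<bar>u\<bar> ^ 3 / 6"
        using iexp_approx1[of u 2] by (simp only:)
      show "norm ((tilt \<theta> y - 1) * (iexp u - 1)) \<le> (\<theta>\<^sup>2 / 2 * L) * \<bar>u\<bar>"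
        unfolding norm_mult using L
        by (intro mult_mono norm_tilt_minus_one_le norm_iexp_minus_one_le) auto
    qed
    also have "\<dots> \<le> (\<bar>\<theta>\<bar> * K) ^ 3 / 6 + (\<theta>\<^sup>2 / 2 * L) * (\<bar>\<theta>\<bar> * K)"
      using u L by (intro add_mono divide_right_mono power_mono mult_left_mono) auto
    also have "\<theta>\<^sup>2 / 2 * L * (\<bar>\<theta>\<bar> * K) = L * K / 2 * \<bar>\<theta>\<bar> ^ 3"
      by (simp add: power3_eq_cube power2_eq_square)
    finally show ?thesis by (simp add: u_def power_mult_distrib algebra_simps)
  qed
  have "norm (step_mean Q \<kappa> x (\<lambda>B y. iexp (\<theta> * g x B y) * tilt \<theta> y) - step_mean Q \<kappa> x T)
      \<le> (K ^ 3 / 6 + L * K / 2) * \<bar>\<theta>\<bar> ^ 3"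
    unfolding step_mean_diff[symmetric] by (rule norm_step_mean_le) (rule err)
  moreover have "norm (step_mean Q \<kappa> x T - complex_of_real (1 - \<theta>\<^sup>2 * s / 2) * tilt \<theta> x)
      \<le> s * L / 4 * \<bar>\<theta>\<bar> ^ 3"
  proof -
    have "step_mean Q \<kappa> x T - complex_of_real (1 - \<theta>\<^sup>2 * s / 2) * tilt \<theta> x =
        complex_of_real (- (s * H x / 4 * \<theta> ^ 4))"
      unfolding T tilt_def of_real_mult[symmetric] of_real_diff[symmetric] of_real_eq_iff
      by (simp add: power2_eq_square power4_eq_xxxx field_simps)
    then have "norm (step_mean Q \<kappa> x T - complex_of_real (1 - \<theta>\<^sup>2 * s / 2) * tilt \<theta> x) =
        s * \<bar>H x\<bar> / 4 * \<bar>\<theta>\<bar> ^ 4"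
      by (simp only: norm_of_real abs_minus_cancel abs_mult abs_divide power_abs
          abs_of_nonneg[OF s_nonneg] abs_numeral)
    \<comment> \<open>Here |\<theta>| \<le> 1 trades the fourth power for the third.\<close>
    also have "\<dots> \<le> s * L / 4 * \<bar>\<theta>\<bar> ^ 3"
      using s_nonneg H_bound \<theta> L
      by (intro mult_mono divide_right_mono mult_left_mono power_decreasing) auto
    finally show ?thesis .
  qed
  ultimately show ?thesis
    unfolding distrib_right[of "K ^ 3 / 6 + L * K / 2"] by (rule norm_diff_triangle_le)
qed

text \<open>Conditioning on the past factors out exp(i \<theta> S_n), of modulus 1, so the one-step
  error bound passes to expectations.\<close>

lemma tilted_transform_step:
  assumes "\<bar>\<theta>\<bar> \<le> 1"
  shows "norm (expectation (\<lambda>\<omega>. iexp (\<theta> * path_sum g (Suc n) \<omega>) * tilt \<theta> (X (Suc n) \<omega>)) -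
      complex_of_real (1 - \<theta>\<^sup>2 * s / 2) * expectation (\<lambda>\<omega>. iexp (\<theta> * path_sum g n \<omega>) * tilt \<theta> (X n \<omega>)))
    \<le> (K ^ 3 / 6 + L * K / 2 + s * L / 4) * \<bar>\<theta>\<bar> ^ 3"
proof -
  let ?e = "\<lambda>\<omega>. iexp (\<theta> * path_sum g n \<omega>)"
  let ?m = "\<lambda>x. step_mean Q \<kappa> x (\<lambda>B y. iexp (\<theta> * g x B y) * tilt \<theta> y)"
  let ?q = "complex_of_real (1 - \<theta>\<^sup>2 * s / 2)"
  have "expectation (\<lambda>\<omega>. iexp (\<theta> * path_sum g (Suc n) \<omega>) * tilt \<theta> (X (Suc n) \<omega>)) =
      expectation (\<lambda>\<omega>. ?e \<omega> *
        (iexp (\<theta> * g (X n \<omega>) (A (Suc n) \<omega>) (X (Suc n) \<omega>)) * tilt \<theta> (X (Suc n) \<omega>)))"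
    by (simp add: path_sum_Suc ring_distribs exp_add mult.assoc)
  also have "\<dots> = expectation (\<lambda>\<omega>. ?e \<omega> * ?m (X n \<omega>))"
    by (rule path_step_expectation[of "\<lambda>s x. iexp (\<theta> * s)" g n
          "\<lambda>x B y. iexp (\<theta> * g x B y) * tilt \<theta> y"])
  finally have "expectation (\<lambda>\<omega>. iexp (\<theta> * path_sum g (Suc n) \<omega>) * tilt \<theta> (X (Suc n) \<omega>)) -
      ?q * expectation (\<lambda>\<omega>. ?e \<omega> * tilt \<theta> (X n \<omega>)) =
      expectation (\<lambda>\<omega>. ?e \<omega> * ?m (X n \<omega>)) - expectation (\<lambda>\<omega>. ?q * (?e \<omega> * tilt \<theta> (X n \<omega>)))"
    by (simp only: integral_mult_right_zero)
  also have "\<dots> = expectation (\<lambda>\<omega>. ?e \<omega> * ?m (X n \<omega>) - ?q * (?e \<omega> * tilt \<theta> (X n \<omega>)))"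
    by (rule Bochner_Integration.integral_diff[symmetric,
          OF path_integrable[of "\<lambda>s x. iexp (\<theta> * s) * ?m x"]
             path_integrable[of "\<lambda>s x. ?q * (iexp (\<theta> * s) * tilt \<theta> x)"]])
  also have "norm \<dots> \<le> (K ^ 3 / 6 + L * K / 2 + s * L / 4) * \<bar>\<theta>\<bar> ^ 3"
  proof (rule norm_expectation_le)
    show "integrable M (\<lambda>\<omega>. ?e \<omega> * ?m (X n \<omega>) - ?q * (?e \<omega> * tilt \<theta> (X n \<omega>)))"
      by (rule path_integrable[of "\<lambda>s x. iexp (\<theta> * s) * ?m x - ?q * (iexp (\<theta> * s) * tilt \<theta> x)"])
    fix \<omega>
    have "?e \<omega> * ?m (X n \<omega>) - ?q * (?e \<omega> * tilt \<theta> (X n \<omega>)) =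
        ?e \<omega> * (?m (X n \<omega>) - ?q * tilt \<theta> (X n \<omega>))" by (simp add: algebra_simps)
    then show "norm (?e \<omega> * ?m (X n \<omega>) - ?q * (?e \<omega> * tilt \<theta> (X n \<omega>)))
        \<le> (K ^ 3 / 6 + L * K / 2 + s * L / 4) * \<bar>\<theta>\<bar> ^ 3"
      using one_step_estimate[OF assms, of "X n \<omega>"] by (simp add: norm_mult)
  qed
  finally show ?thesis .
qed

text \<open>Since the factor \<rho> has modulus at most 1, the errors of the \<open>n\<close> steps
  merely add up. Removing the tilt at time \<open>n\<close> and at time 0 costs \<theta>^2 L / 2
  each.\<close>

lemma transform_estimate:
  assumes \<theta>: "\<bar>\<theta>\<bar> \<le> 1" and q: "\<bar>1 - \<theta>\<^sup>2 * s / 2\<bar> \<le> 1"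
  shows "norm (expectation (\<lambda>\<omega>. iexp (\<theta> * path_sum g n \<omega>)) - complex_of_real ((1 - \<theta>\<^sup>2 * s / 2) ^ n))
    \<le> n * ((K ^ 3 / 6 + L * K / 2 + s * L / 4) * \<bar>\<theta>\<bar> ^ 3) + \<theta>\<^sup>2 * L"
proof -
  let ?C = "(K ^ 3 / 6 + L * K / 2 + s * L / 4) * \<bar>\<theta>\<bar> ^ 3"
  define \<rho> where "\<rho> = complex_of_real (1 - \<theta>\<^sup>2 * s / 2)"
  have \<rho>: "norm \<rho> \<le> 1" using q by (simp only: \<rho>_def norm_of_real)
  define a where "a n = expectation (\<lambda>\<omega>. iexp (\<theta> * path_sum g n \<omega>) * tilt \<theta> (X n \<omega>))" for n
  have untilt: "norm (expectation (\<lambda>\<omega>. iexp (\<theta> * path_sum g n \<omega>)) - a n) \<le> \<theta>\<^sup>2 / 2 * L" for n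
  proof -
    have "expectation (\<lambda>\<omega>. iexp (\<theta> * path_sum g n \<omega>)) - a n =
        expectation (\<lambda>\<omega>. iexp (\<theta> * path_sum g n \<omega>) - iexp (\<theta> * path_sum g n \<omega>) * tilt \<theta> (X n \<omega>))"
      unfolding a_def
      by (rule Bochner_Integration.integral_diff[symmetric,
            OF path_integrable[of "\<lambda>s x. iexp (\<theta> * s)"]
               path_integrable[of "\<lambda>s x. iexp (\<theta> * s) * tilt \<theta> x"]])
    also have "norm \<dots> \<le> \<theta>\<^sup>2 / 2 * L"
    proof (rule norm_expectation_le)
      show "integrable M (\<lambda>\<omega>. iexp (\<theta> * path_sum g n \<omega>) - iexp (\<theta> * path_sum g n \<omega>) * tilt \<theta> (X n \<omega>))"
        by (rule path_integrable[of "\<lambda>s x. iexp (\<theta> * s) - iexp (\<theta> * s) * tilt \<theta> x"])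
      fix \<omega>
      have "iexp (\<theta> * path_sum g n \<omega>) - iexp (\<theta> * path_sum g n \<omega>) * tilt \<theta> (X n \<omega>) =
          - (iexp (\<theta> * path_sum g n \<omega>) * (tilt \<theta> (X n \<omega>) - 1))" by (simp add: algebra_simps)
      then show "norm (iexp (\<theta> * path_sum g n \<omega>) - iexp (\<theta> * path_sum g n \<omega>) * tilt \<theta> (X n \<omega>))
          \<le> \<theta>\<^sup>2 / 2 * L"
        using norm_tilt_minus_one_le[of \<theta> "X n \<omega>"]
        by (simp only: norm_minus_cancel norm_mult norm_exp_i_times mult_1)
    qed
    finally show ?thesis .
  qed
  have "norm (a n - \<rho> ^ n * a 0) \<le> n * ?C"
  proof (induction n)
    case (Suc n)
    have "a (Suc n) - \<rho> ^ Suc n * a 0 = (a (Suc n) - \<rho> * a n) + \<rho> * (a n - \<rho> ^ n * a 0)"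
      by (simp add: algebra_simps)
    also have "norm \<dots> \<le> ?C + 1 * (n * ?C)"
    proof (intro order.trans[OF norm_triangle_ineq] add_mono)
      show "norm (a (Suc n) - \<rho> * a n) \<le> ?C"
        unfolding a_def \<rho>_def by (rule tilted_transform_step[OF \<theta>])
      show "norm (\<rho> * (a n - \<rho> ^ n * a 0)) \<le> 1 * (n * ?C)"
        unfolding norm_mult using Suc \<rho> by (intro mult_mono) auto
    qed
    finally show ?case
      using distrib_right[of 1 "real n" ?C] by (simp only: of_nat_Suc mult_1_left)
  qed simp
  moreover have "norm (\<rho> ^ n * a 0 - \<rho> ^ n) \<le> \<theta>\<^sup>2 / 2 * L"
  proof -
    have "expectation (\<lambda>\<omega>. iexp (\<theta> * path_sum g 0 \<omega>)) = 1"
      by (simp add: path_sum_def prob_space)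
    then have "norm (a 0 - 1) \<le> \<theta>\<^sup>2 / 2 * L" using untilt[of 0] by (simp add: norm_minus_commute)
    moreover have "\<rho> ^ n * a 0 - \<rho> ^ n = \<rho> ^ n * (a 0 - 1)" by (simp add: algebra_simps)
    moreover have "norm (\<rho> ^ n) \<le> 1" using \<rho> by (simp add: norm_power power_le_one)
    ultimately show ?thesis
      using mult_mono[of "norm (\<rho> ^ n)" 1 "norm (a 0 - 1)" "\<theta>\<^sup>2 / 2 * L"] by (simp add: norm_mult)
  qed
  ultimately have "norm (expectation (\<lambda>\<omega>. iexp (\<theta> * path_sum g n \<omega>)) - \<rho> ^ n)
      \<le> \<theta>\<^sup>2 / 2 * L + (n * ?C + \<theta>\<^sup>2 / 2 * L)"
    by (intro norm_diff_triangle_le[OF untilt] norm_diff_triangle_le)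
  then have "norm (expectation (\<lambda>\<omega>. iexp (\<theta> * path_sum g n \<omega>)) - \<rho> ^ n) \<le> n * ?C + \<theta>\<^sup>2 * L"
    by linarith
  then show ?thesis by (simp only: \<rho>_def of_real_power)
qed

text \<open>With \<theta> = t / sqrt n the accumulated error is of order |\<theta>| + \<theta>^2,
  and (1 - s t^2 / (2 n))^n tends to the Gaussian transform.\<close>

lemma path_sum_char_limit:
  "(\<lambda>n. expectation (\<lambda>\<omega>. iexp (t / sqrt n * path_sum g n \<omega>))) \<longlonglongrightarrow>
    complex_of_real (exp (- (s * t\<^sup>2) / 2))"
proof -
  define C where "C = K ^ 3 / 6 + L * K / 2 + s * L / 4"
  let ?\<theta> = "\<lambda>n. t / sqrt (real n)"
  let ?q = "\<lambda>n. 1 - (?\<theta> n)\<^sup>2 * s / 2"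
  have \<theta>0: "?\<theta> \<longlonglongrightarrow> 0" by real_asymp
  have small: "\<forall>\<^sub>F n in sequentially. \<bar>?\<theta> n\<bar> \<le> 1"
    using order_tendstoD(2)[OF tendsto_rabs[OF \<theta>0], of 1] by (auto elim: eventually_mono)
  have "(\<lambda>n. (?\<theta> n)\<^sup>2 * s / 2) \<longlonglongrightarrow> 0\<^sup>2 * s / 2" by (intro tendsto_intros \<theta>0) simp
  then have "\<forall>\<^sub>F n in sequentially. (?\<theta> n)\<^sup>2 * s / 2 < 1"
    by (rule order_tendstoD(2)) simp
  then have q1: "\<forall>\<^sub>F n in sequentially. \<bar>?q n\<bar> \<le> 1"
    by eventually_elim (use s_nonneg in \<open>simp add: abs_le_iff\<close>)
  \<comment> \<open>The case \<open>n = 0\<close> holds because \<open>t / sqrt 0\<close> is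
    0.\<close>
  have "real n * (C * \<bar>?\<theta> n\<bar> ^ 3) + (?\<theta> n)\<^sup>2 * L = C * t\<^sup>2 * \<bar>?\<theta> n\<bar> + (?\<theta> n)\<^sup>2 * L" for n
    by (cases "n = 0") (simp_all add: power3_eq_cube power2_eq_square)
  moreover have "(\<lambda>n. C * t\<^sup>2 * \<bar>?\<theta> n\<bar> + (?\<theta> n)\<^sup>2 * L) \<longlonglongrightarrow> C * t\<^sup>2 * \<bar>0\<bar> + 0\<^sup>2 * L"
    by (intro tendsto_intros \<theta>0)
  ultimately have bnd: "(\<lambda>n. real n * (C * \<bar>?\<theta> n\<bar> ^ 3) + (?\<theta> n)\<^sup>2 * L) \<longlonglongrightarrow> 0"
    by simp
  have "(\<lambda>n. expectation (\<lambda>\<omega>. iexp (?\<theta> n * path_sum g n \<omega>)) - complex_of_real (?q n ^ n)) \<longlonglongrightarrow> 0"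
  proof (rule Lim_null_comparison[OF _ bnd])
    show "\<forall>\<^sub>F n in sequentially. norm (expectation (\<lambda>\<omega>. iexp (?\<theta> n * path_sum g n \<omega>)) -
        complex_of_real (?q n ^ n)) \<le> real n * (C * \<bar>?\<theta> n\<bar> ^ 3) + (?\<theta> n)\<^sup>2 * L"
      using small q1 by eventually_elim (unfold C_def, rule transform_estimate)
  qed
  moreover have "(\<lambda>n. complex_of_real (?q n ^ n)) \<longlonglongrightarrow> complex_of_real (exp (- (s * t\<^sup>2) / 2))"
  proof (rule tendsto_of_real)
    have "(\<lambda>n. (1 + (- (s * t\<^sup>2) / 2) / real n) ^ n) \<longlonglongrightarrow> exp (- (s * t\<^sup>2) / 2)"
      by (rule tendsto_exp_limit_sequentially)
    then show "(\<lambda>n. ?q n ^ n) \<longlonglongrightarrow> exp (- (s * t\<^sup>2) / 2)"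
      by (simp add: power_divide mult.commute)
  qed
  ultimately show ?thesis using tendsto_add by fastforce
qed

text \<open>Levy continuity, with room for a boundary term: an O(1 / sqrt n) perturbation of the
  normalised sum changes the characteristic function at \<open>t\<close> by at most |t| c / sqrt
  n.\<close>

lemma path_sum_central_limit:
  assumes Z: "\<And>n. Z n \<in> borel_measurable M"
    and close: "\<And>n \<omega>. \<bar>Z n \<omega> - path_sum g n \<omega> / sqrt n\<bar> \<le> c / sqrt n"
  shows "weak_conv_m (\<lambda>n. distr M borel (Z n)) (normal_law 0 s)"
proof (rule levy_continuity)
  show "real_distribution (distr M borel (Z n))" for n using Z by (rule real_distribution_distr)
  show "real_distribution (normal_law 0 s)" using s_nonneg by (rule real_distribution_normal_law)
  fix t
  note Z [measurable]
  have int: "integrable M (\<lambda>\<omega>. iexp (t * Z n \<omega>))" for n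
    by (rule integrable_const_bound[of _ 1]) auto
  have "(\<lambda>n. char (distr M borel (Z n)) t - expectation (\<lambda>\<omega>. iexp (t / sqrt n * path_sum g n \<omega>))) \<longlonglongrightarrow> 0"
  proof (rule Lim_null_comparison[OF always_eventually])
    show "\<forall>n. norm (char (distr M borel (Z n)) t - expectation (\<lambda>\<omega>. iexp (t / sqrt n * path_sum g n \<omega>)))
        \<le> \<bar>t\<bar> * (c / sqrt n)"
    proof
      fix n :: nat
      have "char (distr M borel (Z n)) t - expectation (\<lambda>\<omega>. iexp (t / sqrt n * path_sum g n \<omega>)) =
          expectation (\<lambda>\<omega>. iexp (t * Z n \<omega>) - iexp (t / sqrt n * path_sum g n \<omega>))"
        by (subst Bochner_Integration.integral_diff[OF int path_integrable[of "\<lambda>s x. iexp (t / sqrt n * s)"]])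
          (simp add: char_def integral_distr)
      also have "norm \<dots> \<le> \<bar>t\<bar> * (c / sqrt n)"
      proof (rule norm_expectation_le)
        show "integrable M (\<lambda>\<omega>. iexp (t * Z n \<omega>) - iexp (t / sqrt n * path_sum g n \<omega>))"
          by (rule Bochner_Integration.integrable_diff[OF int path_integrable[of "\<lambda>s x. iexp (t / sqrt n * s)"]])
        fix \<omega>
        have "t * Z n \<omega> - t / sqrt n * path_sum g n \<omega> = t * (Z n \<omega> - path_sum g n \<omega> / sqrt n)"
          by (simp add: algebra_simps)
        then have "\<bar>t * Z n \<omega> - t / sqrt n * path_sum g n \<omega>\<bar> \<le> \<bar>t\<bar> * (c / sqrt n)"
          using close[of n \<omega>] by (simp only: abs_mult mult_left_mono abs_ge_zero)
        then show "norm (iexp (t * Z n \<omega>) - iexp (t / sqrt n * path_sum g n \<omega>)) \<le> \<bar>t\<bar> * (c / sqrt n)"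
          by (rule order.trans[OF norm_iexp_diff_le])
      qed
      finally show "norm (char (distr M borel (Z n)) t - expectation (\<lambda>\<omega>. iexp (t / sqrt n * path_sum g n \<omega>)))
        \<le> \<bar>t\<bar> * (c / sqrt n)" .
    qed
    show "(\<lambda>n. \<bar>t\<bar> * (c / sqrt (real n))) \<longlonglongrightarrow> 0" by real_asymp
  qed
  from tendsto_add[OF this path_sum_char_limit[of t]]
  show "(\<lambda>n. char (distr M borel (Z n)) t) \<longlonglongrightarrow> char (normal_law 0 s) t"
    by (simp add: char_normal_law[OF s_nonneg])
qed

end

subsection \<open>The estimator\<close>

text \<open>Substituting f = F - PF + \<open>mean \<pi> f\<close> and adding and subtracting PF(X_k)
  splits each summand into an increment, the mean and a telescoping difference.\<close>

lemma estimator_martingale: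
  assumes "poisson_solution \<pi> (transition Q \<kappa>) f F" "0 < n"
  shows "real n * (estimator \<kappa> X A f \<psi> n \<omega> - mean \<pi> f) = path_sum (increment F \<psi>) n \<omega> +
    (apply_matrix (transition Q \<kappa>) F (X 0 \<omega>) - apply_matrix (transition Q \<kappa>) F (X n \<omega>))"
proof -
  let ?P = "apply_matrix (transition Q \<kappa>) F"
  have f: "f x = F x - ?P x + mean \<pi> f" for x
    using assms(1) by (simp add: poisson_solution_def)
  have "real n * estimator \<kappa> X A f \<psi> n \<omega> = (\<Sum>k<n. f (X (Suc k) \<omega>)) +
      (\<Sum>k<n. (\<Sum>y\<in>A (Suc k) \<omega>. \<kappa> (X k \<omega>) (A (Suc k) \<omega>) y * \<psi> y) - \<psi> (X (Suc k) \<omega>))"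
    using assms(2) sum.shift_bounds_Suc_ivl[of "\<lambda>k. f (X k \<omega>)" 0 n]
    by (simp add: estimator_def empirical_mean_def correction_def ring_distribs
        atLeast0LessThan atLeastLessThanSuc_atLeastAtMost)
  also have "\<dots> = (\<Sum>k<n. increment F \<psi> (X k \<omega>) (A (Suc k) \<omega>) (X (Suc k) \<omega>) + mean \<pi> f
      + (?P (X k \<omega>) - ?P (X (Suc k) \<omega>)))"
    unfolding sum.distrib[symmetric]
    by (intro sum.cong refl, subst f) (simp add: increment_def)
  also have "\<dots> = path_sum (increment F \<psi>) n \<omega> + real n * mean \<pi> f + (?P (X 0 \<omega>) - ?P (X n \<omega>))"
    by (simp add: sum.distrib path_sum_def sum_lessThan_telescope'[of "\<lambda>k. ?P (X k \<omega>)"])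
  finally show ?thesis by (simp add: algebra_simps)
qed

lemma increment_bounded:
  "\<exists>K. \<forall>x B y. \<bar>increment F \<psi> x B y\<bar> \<le> K"
  using finite_function_bounded[of "\<lambda>(x, B, y). increment F \<psi> x B y"] by auto

lemma estimator_consistent:
  assumes F: "poisson_solution \<pi> (transition Q \<kappa>) f F"
  shows "AE \<omega> in M. (\<lambda>n. estimator \<kappa> X A f \<psi> n \<omega>) \<longlonglongrightarrow> mean \<pi> f"
proof -
  let ?P = "apply_matrix (transition Q \<kappa>) F"
  obtain K where K: "\<And>x B y. \<bar>increment F \<psi> x B y\<bar> \<le> K" using increment_bounded[of F \<psi>] by blast
  obtain p where p: "\<And>x. \<bar>?P x\<bar> \<le> p" using finite_function_bounded[of ?P] by blast
  have "AE \<omega> in M. (\<lambda>n. path_sum (increment F \<psi>) n \<omega> / n) \<longlonglongrightarrow> 0"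
    using step_mean_increment K by (rule path_sum_strong_law)
  then show ?thesis
  proof eventually_elim
    case (elim \<omega>)
    have "(\<lambda>n. (?P (X 0 \<omega>) - ?P (X n \<omega>)) / real n) \<longlonglongrightarrow> 0"
    proof (rule Lim_null_comparison[OF always_eventually[OF allI]])
      fix n
      have "\<bar>?P (X 0 \<omega>) - ?P (X n \<omega>)\<bar> \<le> 2 * p" using p[of "X 0 \<omega>"] p[of "X n \<omega>"] by linarith
      then show "norm ((?P (X 0 \<omega>) - ?P (X n \<omega>)) / real n) \<le> 2 * p / real n"
        by (simp add: divide_right_mono)
    next
      show "(\<lambda>n. 2 * p / real n) \<longlonglongrightarrow> 0" by real_asymp
    qed
    from tendsto_add_zero[OF elim this]
    have "(\<lambda>n. estimator \<kappa> X A f \<psi> n \<omega> - mean \<pi> f) \<longlonglongrightarrow> 0"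
    proof (rule Lim_transform_eventually)
      show "\<forall>\<^sub>F n in sequentially. path_sum (increment F \<psi>) n \<omega> / real n +
          (?P (X 0 \<omega>) - ?P (X n \<omega>)) / real n = estimator \<kappa> X A f \<psi> n \<omega> - mean \<pi> f"
        \<comment> \<open>The martingale identity is available for positive \<open>n\<close>, which
          suffices for the limit.\<close>
        using eventually_gt_at_top[of 0]
      proof eventually_elim
        case (elim n)
        then have "estimator \<kappa> X A f \<psi> n \<omega> - mean \<pi> f =
            real n * (estimator \<kappa> X A f \<psi> n \<omega> - mean \<pi> f) / real n" by simp
        then show ?case by (simp only: estimator_martingale[OF F elim] add_divide_distrib)
      qed
    qed
    then show ?case by (simp add: LIM_zero_iff)
  qed
qed

lemma estimator_measurable: "estimator \<kappa> X A f \<psi> n \<in> borel_measurable M"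
proof -
  have "integrable M (\<lambda>\<omega>. (\<Sum>y\<in>A (Suc k) \<omega>. \<kappa> (X k \<omega>) (A (Suc k) \<omega>) y * \<psi> y) - \<psi> (X (Suc k) \<omega>))" for k
    by (rule path_step_integrable[of "\<lambda>s x B y. (\<Sum>z\<in>B. \<kappa> x B z * \<psi> z) - \<psi> y"])
  note [measurable] = borel_measurable_integrable[OF this]
  have [measurable]: "(\<lambda>\<omega>. f (X k \<omega>)) \<in> borel_measurable M" for k
    by measurable
  show ?thesis
    unfolding estimator_def[abs_def] empirical_mean_def correction_def by measurable
qed

lemma estimator_central_limit:
  assumes \<pi>: "positive_prob \<pi>" and bal: "balanced \<pi> Q \<kappa>"
    and irr: "irreducible_matrix (transition Q \<kappa>)"
    and F: "poisson_solution \<pi> (transition Q \<kappa>) f F"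
  shows "weak_conv_m
    (\<lambda>n. distr M borel (\<lambda>\<omega>. sqrt (real n) * (estimator \<kappa> X A f \<psi> n \<omega> - mean \<pi> f)))
    (normal_law 0 (asymp_var_cv \<pi> Q \<kappa> F \<psi>))"
proof -
  let ?P = "apply_matrix (transition Q \<kappa>) F"
  let ?v = "\<lambda>x. step_mean Q \<kappa> x (\<lambda>B y. (increment F \<psi> x B y)\<^sup>2)"
  obtain K where K: "\<And>x B y. \<bar>increment F \<psi> x B y\<bar> \<le> K" using increment_bounded[of F \<psi>] by blast
  obtain p where p: "\<And>x. \<bar>?P x\<bar> \<le> p" using finite_function_bounded[of ?P] by blast
  \<comment> \<open>\<open>H\<close> is the corrector: a second Poisson equation, now for the
    one-step variance, whose stationary mean is the asymptotic variance.\<close>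
  obtain H where "poisson_solution \<pi> (transition Q \<kappa>) ?v H"
    using poisson_solution_exists[OF \<pi> bal irr] by blast
  then have H: "H x - apply_matrix (transition Q \<kappa>) H x = ?v x - asymp_var_cv \<pi> Q \<kappa> F \<psi>" for x
    by (simp add: poisson_solution_def asymp_var_cv_eq[OF bal])
  obtain L where L: "\<And>x. \<bar>H x\<bar> \<le> L" using finite_function_bounded[of H] by blast
  show ?thesis
  proof (rule path_sum_central_limit[OF step_mean_increment K L asymp_var_cv_nonneg[OF \<pi> bal] H])
    show "(\<lambda>\<omega>. sqrt (real n) * (estimator \<kappa> X A f \<psi> n \<omega> - mean \<pi> f)) \<in> borel_measurable M" for n
      using estimator_measurable[of f \<psi> n] by measurable
    show "\<bar>sqrt (real n) * (estimator \<kappa> X A f \<psi> n \<omega> - mean \<pi> f) - path_sum (increment F \<psi>) n \<omega> / sqrt n\<bar>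
        \<le> 2 * p / sqrt n" for n \<omega>
    \<comment> \<open>At \<open>n = 0\<close> both sides are 0, as \<open>sqrt 0\<close> is 0 and so
      is any quotient by it.\<close>
    proof (cases "n = 0")
      case False
      have "sqrt (real n) * (estimator \<kappa> X A f \<psi> n \<omega> - mean \<pi> f) =
          real n * (estimator \<kappa> X A f \<psi> n \<omega> - mean \<pi> f) / sqrt n"
        by (simp only: times_divide_eq_left[symmetric] real_div_sqrt of_nat_0_le_iff)
      then have "sqrt (real n) * (estimator \<kappa> X A f \<psi> n \<omega> - mean \<pi> f) - path_sum (increment F \<psi>) n \<omega> / sqrt n =
          (?P (X 0 \<omega>) - ?P (X n \<omega>)) / sqrt n"
        using False by (simp add: estimator_martingale[OF F] add_divide_distrib)
      then show ?thesis
        using p[of "X 0 \<omega>"] p[of "X n \<omega>"] by (simp add: divide_right_mono)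
    qed simp
  qed
qed

end

theorem proposition2p7:
  fixes \<pi> \<nu>\<^sub>0 :: "'a::finite \<Rightarrow> real"
    and Q :: "'a \<Rightarrow> 'a set \<Rightarrow> real"
    and \<kappa> :: "'a \<Rightarrow> 'a set \<Rightarrow> 'a \<Rightarrow> real"
    and M :: "'w measure"
    and X :: "nat \<Rightarrow> 'w \<Rightarrow> 'a"
    and A :: "nat \<Rightarrow> 'w \<Rightarrow> 'a set"
    and f :: "'a \<Rightarrow> real"
  assumes "positive_prob \<pi>"
    and "proposal_kernel Q"
    and "selection_probability \<kappa>"
    and "balanced \<pi> Q \<kappa>"
    and "proposal_chain M \<nu>\<^sub>0 Q \<kappa> X A"
    and "irreducible_matrix (transition Q \<kappa>)"
  shows "(\<forall>\<psi>. AE \<omega> in M. (\<lambda>n. estimator \<kappa> X A f \<psi> n \<omega>) \<longlonglongrightarrow> mean \<pi> f) \<and>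
    (\<exists>F. poisson_solution \<pi> (transition Q \<kappa>) f F) \<and>
    (\<forall>F. poisson_solution \<pi> (transition Q \<kappa>) f F \<longrightarrow>
      (\<forall>\<psi>. 0 \<le> asymp_var_cv \<pi> Q \<kappa> F \<psi> \<and>
        weak_conv_m
          (\<lambda>n. distr M borel (\<lambda>\<omega>. sqrt (real n) * (estimator \<kappa> X A f \<psi> n \<omega> - mean \<pi> f)))
          (normal_law 0 (asymp_var_cv \<pi> Q \<kappa> F \<psi>))) \<and>
      (\<forall>\<psi>. asymp_var_cv \<pi> Q \<kappa> F F \<le> asymp_var_cv \<pi> Q \<kappa> F \<psi>) \<and>
      asymp_var_cv \<pi> Q \<kappa> F F \<le> asymp_var \<pi> (transition Q \<kappa>) F)"
proof -
  interpret sampled_chain Q \<kappa> M \<nu>\<^sub>0 X A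
    using assms(2,3,5)
    by (simp add: sampled_chain_def proposal_pair_def sampled_chain_axioms_def proposal_chain_def)
  \<comment> \<open>The consistency claim does not mention \<open>F\<close>; the existence of a
    Poisson solution provides one for \<open>estimator_consistent\<close>.\<close>
  show ?thesis
    using poisson_solution_exists[OF assms(1,4,6), of f] estimator_consistent
      asymp_var_cv_nonneg[OF assms(1,4)] asymp_var_cv_minimal[OF assms(1)]
      estimator_central_limit[OF assms(1,4,6)]
    by blast
qed

end
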